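(* Let $\eta_\mu,\eta_\Sigma>0$, let $\mu, v_{\mu} \in \mathbb{R}^{d}$, $A\in \mathrm{GL}_{d}(\mathbb{R})$, $\Sigma=AA^T$, and let $v_{\Sigma} \in \mathrm{M}_{d}(\mathbb{R})$ be symmetric. Then the GIGO and xNES updates starting at $\mathcal{N} (\mu ,\Sigma)$ with initial speeds $v_{\mu}$ and $v_{\Sigma}$ follow the same trajectory if and only if the mean remains constant. In other words: $$T_{\mathrm{GIGO}} (\mu , \Sigma , v_{\mu}, v_{\Sigma} )=T_{\mathrm{xNES}} (\mu , \Sigma , v_{\mu}, v_{\Sigma})\quad\text{if and only if}\quad v_{\mu} = 0.$$
   Context: For $\eta_\mu,\eta_\Sigma>0$, $\mathbb{G}_d(\eta_\mu,\eta_\Sigma)$ is the manifold of nondegenerate Gaussian distributions $\mathcal N(\mu,\Sigma)$ on $\mathbb{R}^d$ ($\mu\in\mathbb{R}^d$, $\Sigma$ symmetric positive definite), equipped with the $(\eta_\mu,\eta_\Sigma)$-twisted Fisher metric, for which the squared norm of a tangent vector $(\dot\mu,\dot\Sigma)$ ($\dot\Sigma$ symmetric) at $\mathcal N(\mu,\Sigma)$ is $$\tfrac1{\eta_\mu}\dot\mu^{T}\Sigma^{-1}\dot\mu+\tfrac1{2\eta_\Sigma}\operatorname{tr}(\Sigma^{-1}\dot\Sigma\Sigma^{-1}\dot\Sigma).$$ The update trajectories are the following curves in $\mathbb{G}_d(\eta_\mu,\eta_\Sigma)$, as functions of the step size $\delta t$: GIGO: $T_{\mathrm{GIGO}}(\mu,\Sigma,v_\mu,v_\Sigma):\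 \delta t\mapsto \exp_{\mathcal N(\mu,\Sigma)}(\delta t\,\eta_\mu v_\mu,\ \delta t\,\eta_\Sigma v_\Sigma)$, where $\exp$ is the Riemannian exponential of $\mathbb{G}_d(\eta_\mu,\eta_\Sigma)$. xNES: $T_{\mathrm{xNES}}(\mu,\Sigma,v_\mu,v_\Sigma):\ \delta t\mapsto \mathcal N\left(\mu+\delta t\,\eta_\mu v_\mu,\ A\exp\left[\eta_\Sigma\,\delta t\,A^{-1}v_\Sigma (A^{-1})^{T}\right]A^{T}\right)$, where $AA^{T}=\Sigma$ and $\exp$ is the matrix exponential (this does not depend on the choice of $A$). *)

theory Defs
  imports "HOL-Analysis.Analysis"
begin

section \<open>Riemannian metrics on a relatively open subset of a linear subspace\<close>

text \<open>
  \<open>M\<close> is a relatively open subset of the linear subspace \<open>V\<close> of a normed space, so that \<open>V\<close> is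
  the tangent space of \<open>M\<close> at each of its points and the inclusion is a global chart; \<open>g p\<close> is the
  inner product on \<open>V\<close> at \<open>p \<in> M\<close>.  The covariant derivative of the Levi-Civita connection is
  \<open>(\<nabla>\<^sub>X Y) p = (D Y p) (X p) + \<Gamma>\<^sub>p (X p) (Y p)\<close>, where \<open>\<Gamma>\<^sub>p\<close> is given by the Koszul formula for
  constant vector fields.
\<close>

definition metric_deriv :: "('a::real_normed_vector \<Rightarrow> 'a \<Rightarrow> 'a \<Rightarrow> real) \<Rightarrow> 'a \<Rightarrow> 'a \<Rightarrow> 'a \<Rightarrow> 'a \<Rightarrow> real" where
  "metric_deriv g p u v w = deriv (\<lambda>t. g (p + t *\<^sub>R u) v w) 0"

definition christoffel ::
  "'a set \<Rightarrow> ('a::real_normed_vector \<Rightarrow> 'a \<Rightarrow> 'a \<Rightarrow> real) \<Rightarrow> 'a \<Rightarrow> 'a \<Rightarrow> 'a \<Rightarrow> 'a" where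
  "christoffel V g p u v =
     (THE z. z \<in> V \<and> (\<forall>w\<in>V. 2 * g p z w =
        metric_deriv g p u v w + metric_deriv g p v u w - metric_deriv g p w u v))"

text \<open>\<open>c'\<close> is the velocity of \<open>c\<close>; the condition on its derivative says that the covariant derivative
  of \<open>c'\<close> along \<open>c\<close> vanishes.\<close>

definition is_geodesic ::
  "'a set \<Rightarrow> 'a set \<Rightarrow> ('a::real_normed_vector \<Rightarrow> 'a \<Rightarrow> 'a \<Rightarrow> real) \<Rightarrow> real set
     \<Rightarrow> (real \<Rightarrow> 'a) \<Rightarrow> (real \<Rightarrow> 'a) \<Rightarrow> bool" where
  "is_geodesic V M g I c c' \<longleftrightarrow>
     (\<forall>t\<in>I. c t \<in> M
        \<and> (c has_vector_derivative c' t) (at t)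
        \<and> (c' has_vector_derivative - christoffel V g (c t) (c' t) (c' t)) (at t))"

text \<open>Meaningful for those \<open>v \<in> V\<close> whose geodesic is defined up to time 1.\<close>

definition riemannian_exp ::
  "'a set \<Rightarrow> 'a set \<Rightarrow> ('a::real_normed_vector \<Rightarrow> 'a \<Rightarrow> 'a \<Rightarrow> real) \<Rightarrow> 'a \<Rightarrow> 'a \<Rightarrow> 'a" where
  "riemannian_exp V M g p v =
     (THE q. \<exists>I c c'. open I \<and> is_interval I \<and> 0 \<in> I \<and> 1 \<in> I
        \<and> is_geodesic V M g I c c' \<and> c 0 = p \<and> c' 0 = v \<and> c 1 = q)"


section \<open>Gaussian distributions with the twisted Fisher metric\<close>

definition sym_matrix :: "real^'d^'d \<Rightarrow> bool" where
  "sym_matrix S \<longleftrightarrow> transpose S = S"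

definition pos_def :: "real^'d^'d \<Rightarrow> bool" where
  "pos_def S \<longleftrightarrow> sym_matrix S \<and> (\<forall>x. x \<noteq> 0 \<longrightarrow> 0 < x \<bullet> (S *v x))"

definition gaussian :: "real^'d \<Rightarrow> real^'d^'d \<Rightarrow> (real^'d) measure" where
  "gaussian m S = density lborel
     (\<lambda>x. ennreal (exp (- ((x - m) \<bullet> (matrix_inv S *v (x - m))) / 2)
                      / sqrt ((2 * pi) ^ CARD('d) * det S)))"

text \<open>The manifold of nondegenerate Gaussian distributions in the global chart \<open>(\<mu>, \<Sigma>)\<close>.\<close>

definition gauss_params :: "((real^'d) \<times> (real^'d^'d)) set" where
  "gauss_params = UNIV \<times> {S. pos_def S}"

definition gauss_tangent :: "((real^'d) \<times> (real^'d^'d)) set" where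
  "gauss_tangent = UNIV \<times> {S. sym_matrix S}"

text \<open>The inner product obtained by polarization from the squared norm
  \<open>\<mu>'\<^sup>T \<Sigma>\<^sup>-\<^sup>1 \<mu>' / \<eta>\<^sub>\<mu> + tr (\<Sigma>\<^sup>-\<^sup>1 \<Sigma>' \<Sigma>\<^sup>-\<^sup>1 \<Sigma>') / (2 \<eta>\<^sub>\<Sigma>)\<close>.\<close>

definition twisted_fisher ::
  "real \<Rightarrow> real \<Rightarrow> (real^'d) \<times> (real^'d^'d) \<Rightarrow> (real^'d) \<times> (real^'d^'d) \<Rightarrow> (real^'d) \<times> (real^'d^'d) \<Rightarrow> real" where
  "twisted_fisher \<eta>\<^sub>\<mu> \<eta>\<^sub>\<Sigma> = (\<lambda>(m, S) (u, X) (v, Y).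
     1 / \<eta>\<^sub>\<mu> * (u \<bullet> (matrix_inv S *v v))
     + 1 / (2 * \<eta>\<^sub>\<Sigma>) * trace (matrix_inv S ** X ** matrix_inv S ** Y))"

definition gauss_exp ::
  "real \<Rightarrow> real \<Rightarrow> (real^'d) \<times> (real^'d^'d) \<Rightarrow> (real^'d) \<times> (real^'d^'d) \<Rightarrow> (real^'d) \<times> (real^'d^'d)" where
  "gauss_exp \<eta>\<^sub>\<mu> \<eta>\<^sub>\<Sigma> = riemannian_exp gauss_tangent gauss_params (twisted_fisher \<eta>\<^sub>\<mu> \<eta>\<^sub>\<Sigma>)"


section \<open>Update trajectories\<close>

text \<open>The type of square matrices is not an instance of the class on which the library exponential
  is defined (and its \<open>*\<close> is componentwise), hence the explicit series.\<close>

definition matrix_exp :: "real^'d^'d \<Rightarrow> real^'d^'d" where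
  "matrix_exp X = (\<Sum>k. (1 / fact k) *\<^sub>R (((**) X ^^ k) (mat 1)))"

definition gigo_trajectory ::
  "real \<Rightarrow> real \<Rightarrow> real^'d \<Rightarrow> real^'d^'d \<Rightarrow> real^'d \<Rightarrow> real^'d^'d \<Rightarrow> real \<Rightarrow> (real^'d) measure" where
  "gigo_trajectory \<eta>\<^sub>\<mu> \<eta>\<^sub>\<Sigma> m S v\<^sub>\<mu> v\<^sub>\<Sigma> = (\<lambda>\<delta>t.
     case gauss_exp \<eta>\<^sub>\<mu> \<eta>\<^sub>\<Sigma> (m, S) ((\<delta>t * \<eta>\<^sub>\<mu>) *\<^sub>R v\<^sub>\<mu>, (\<delta>t * \<eta>\<^sub>\<Sigma>) *\<^sub>R v\<^sub>\<Sigma>) of (m', S') \<Rightarrow> gaussian m' S')"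

text \<open>Parametrized by a factor \<open>A\<close> of the covariance matrix \<open>A ** transpose A\<close>; the trajectory
  depends on \<open>A\<close> only through that product.\<close>

definition xnes_trajectory ::
  "real \<Rightarrow> real \<Rightarrow> real^'d \<Rightarrow> real^'d^'d \<Rightarrow> real^'d \<Rightarrow> real^'d^'d \<Rightarrow> real \<Rightarrow> (real^'d) measure" where
  "xnes_trajectory \<eta>\<^sub>\<mu> \<eta>\<^sub>\<Sigma> m A v\<^sub>\<mu> v\<^sub>\<Sigma> = (\<lambda>\<delta>t.
     gaussian (m + (\<delta>t * \<eta>\<^sub>\<mu>) *\<^sub>R v\<^sub>\<mu>)
       (A ** matrix_exp ((\<eta>\<^sub>\<Sigma> * \<delta>t) *\<^sub>R (matrix_inv A ** v\<^sub>\<Sigma> ** transpose (matrix_inv A))) ** transpose A))"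

end

theory Submission imports Defs begin

text \<open>
  In the coordinates \<open>(m, S)\<close> the geodesic equation of the twisted Fisher metric is
  \<open>m'' = S' S\<^sup>-\<^sup>1 m'\<close> and \<open>S'' = S' S\<^sup>-\<^sup>1 S' - k m' m'\<^sup>T\<close> with \<open>k = \<eta>\<^sub>\<Sigma> / \<eta>\<^sub>\<mu> > 0\<close>
  (\<open>is_geodesic_iff_fisher_geodesic\<close>).  The xNES covariance \<open>S t = A exp (t B) A\<^sup>T\<close> satisfies
  \<open>S'' = S' S\<^sup>-\<^sup>1 S'\<close>, whatever the mean does (\<open>xnes_is_fisher_geodesic\<close>).  If the mean does not
  move, xNES is therefore a geodesic, and it has the initial velocity of GIGO.  Conversely, if both
  trajectories agree, then they agree in their parameters, because a Gaussian distribution determines its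
  mean and covariance (\<open>gaussian_inject\<close>); comparing the two expressions for \<open>S''\<close> at time \<open>0\<close> gives
  \<open>k m' m'\<^sup>T = 0\<close>, so the initial velocity of the mean vanishes (\<open>fisher_geodesic_same_covariance\<close>).

  This argument presupposes that the Riemannian exponential is the endpoint of a geodesic, which
  requires uniqueness of geodesics and, for the converse, existence for short times.  Uniqueness rests on two
  conservation laws that turn the equation into a first-order system
  (\<open>fisher_geodesic_first_integrals\<close>, \<open>fisher_geodesic_unique\<close>).  Existence comes from an explicit
  solution in terms of the matrix functions \<open>cosh (t \<surd>M)\<close> and \<open>sinh (t \<surd>M) / \<surd>M\<close>
  (\<open>fisher_geodesic_exists_normalized\<close>), transported to an arbitrary starting point by an affine change
  of coordinates.
\<close>

section \<open>Bilinear algebra and calculus of square matrices\<close>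

lemma bounded_bilinear_matrix_mult:
  "bounded_bilinear ((**) :: real^'n^'m \<Rightarrow> real^'k^'n \<Rightarrow> real^'k^'m)"
  unfolding bilinear_conv_bounded_bilinear[symmetric] bilinear_def
  by (auto intro!: linearI simp: matrix_add_ldistrib scalar_matrix_assoc matrix_scalar_ac
      matrix_matrix_mult_def vec_eq_iff sum.distrib algebra_simps sum_distrib_left)

lemma bounded_bilinear_matrix_vector_mult:
  "bounded_bilinear ((*v) :: real^'n^'m \<Rightarrow> real^'n \<Rightarrow> real^'m)"
  unfolding bilinear_conv_bounded_bilinear[symmetric] bilinear_def
  by (auto intro!: linearI simp: matrix_vector_mult_def vec_eq_iff sum.distrib algebra_simps
      sum_distrib_left)

lemma bounded_linear_transpose: "bounded_linear (transpose :: real^'n^'m \<Rightarrow> real^'m^'n)"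
  unfolding linear_conv_bounded_linear[symmetric]
  by (auto intro!: linearI simp: transpose_def vec_eq_iff)

definition outer :: "real^'n \<Rightarrow> real^'m \<Rightarrow> real^'m^'n" where
  "outer u v = (\<chi> i j. u $ i * v $ j)"

lemma bounded_bilinear_outer: "bounded_bilinear (outer :: real^'n \<Rightarrow> real^'m \<Rightarrow> real^'m^'n)"
  unfolding bilinear_conv_bounded_bilinear[symmetric] bilinear_def
  by (auto intro!: linearI simp: outer_def vec_eq_iff algebra_simps)

lemmas mm_simps =
  bounded_bilinear.add_left[OF bounded_bilinear_matrix_mult]
  bounded_bilinear.add_right[OF bounded_bilinear_matrix_mult]
  bounded_bilinear.diff_left[OF bounded_bilinear_matrix_mult]
  bounded_bilinear.diff_right[OF bounded_bilinear_matrix_mult]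
  bounded_bilinear.minus_left[OF bounded_bilinear_matrix_mult]
  bounded_bilinear.minus_right[OF bounded_bilinear_matrix_mult]
  bounded_bilinear.scaleR_left[OF bounded_bilinear_matrix_mult]
  bounded_bilinear.scaleR_right[OF bounded_bilinear_matrix_mult]
  bounded_bilinear.zero_left[OF bounded_bilinear_matrix_mult]
  bounded_bilinear.zero_right[OF bounded_bilinear_matrix_mult]

lemmas mv_simps =
  bounded_bilinear.add_left[OF bounded_bilinear_matrix_vector_mult]
  bounded_bilinear.add_right[OF bounded_bilinear_matrix_vector_mult]
  bounded_bilinear.diff_left[OF bounded_bilinear_matrix_vector_mult]
  bounded_bilinear.diff_right[OF bounded_bilinear_matrix_vector_mult]
  bounded_bilinear.minus_left[OF bounded_bilinear_matrix_vector_mult]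
  bounded_bilinear.minus_right[OF bounded_bilinear_matrix_vector_mult]
  bounded_bilinear.scaleR_left[OF bounded_bilinear_matrix_vector_mult]
  bounded_bilinear.scaleR_right[OF bounded_bilinear_matrix_vector_mult]

lemmas outer_simps =
  bounded_bilinear.add_left[OF bounded_bilinear_outer]
  bounded_bilinear.add_right[OF bounded_bilinear_outer]
  bounded_bilinear.diff_left[OF bounded_bilinear_outer]
  bounded_bilinear.diff_right[OF bounded_bilinear_outer]
  bounded_bilinear.scaleR_left[OF bounded_bilinear_outer]
  bounded_bilinear.scaleR_right[OF bounded_bilinear_outer]
  bounded_bilinear.zero_left[OF bounded_bilinear_outer]

lemmas transpose_linear_simps =
  linear_add[OF bounded_linear.linear[OF bounded_linear_transpose]]
  linear_diff[OF bounded_linear.linear[OF bounded_linear_transpose]]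
  linear_scale[OF bounded_linear.linear[OF bounded_linear_transpose]]
  linear_0[OF bounded_linear.linear[OF bounded_linear_transpose]]

lemma mult_outer: "X ** outer u v = outer (X *v u) v"
  by (simp add: outer_def matrix_matrix_mult_def matrix_vector_mult_def vec_eq_iff
      sum_distrib_right mult.assoc)

lemma outer_mult: "outer u v ** X = outer u (transpose X *v v)"
  by (simp add: outer_def matrix_matrix_mult_def matrix_vector_mult_def vec_eq_iff transpose_def
      sum_distrib_left ac_simps del: transpose_matrix_vector)

lemma transpose_outer: "transpose (outer u v) = outer v u"
  by (simp add: outer_def transpose_def vec_eq_iff)

lemma outer_mult_vector: "outer u v *v w = (v \<bullet> w) *\<^sub>R u"
  by (simp add: outer_def matrix_vector_mult_def inner_vec_def vec_eq_iff sum_distrib_left ac_simps)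

text \<open>
  Quadratic forms become traces, to which the cyclic invariance of the trace applies.
\<close>

lemma inner_eq_trace_outer: "u \<bullet> (X *v v) = trace (outer v u ** X)"
  unfolding outer_def trace_def matrix_matrix_mult_def matrix_vector_mult_def inner_vec_def
  by (simp add: sum_distrib_left mult_ac, subst sum.swap, simp add: mult_ac)

lemma inner_matrix_eq_trace: "(X :: real^'n^'m) \<bullet> Y = trace (transpose X ** Y)"
  unfolding trace_def matrix_matrix_mult_def inner_vec_def transpose_def
  by (simp, subst sum.swap, simp)

lemma outer_self_eq_0: "outer u u = 0 \<longleftrightarrow> u = 0"
proof
  assume "outer u u = 0"
  then have "outer u u $ i $ i = 0" for i by simp
  then show "u = 0" by (simp add: outer_def vec_eq_iff)
qed (simp add: outer_simps)

lemma trace_scaleR: "trace (r *\<^sub>R X) = r * trace X" for X :: "real^'n^'n"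
  by (simp add: trace_def sum_distrib_left)

lemma matrix_inv_cancel:
  fixes S :: "real^'n^'n"
  assumes "invertible S"
  shows "matrix_inv S ** S = mat 1" "S ** matrix_inv S = mat 1"
    "matrix_inv S ** (S ** X) = X" "S ** (matrix_inv S ** X) = X"
    "matrix_inv S *v (S *v x) = x" "S *v (matrix_inv S *v x) = x"
proof -
  have *: "S ** matrix_inv S = mat 1 \<and> matrix_inv S ** S = mat 1"
    using assms unfolding invertible_def matrix_inv_def by (rule someI_ex)
  then show "matrix_inv S ** S = mat 1" "S ** matrix_inv S = mat 1"
    "matrix_inv S ** (S ** X) = X" "S ** (matrix_inv S ** X) = X"
    "matrix_inv S *v (S *v x) = x" "S *v (matrix_inv S *v x) = x"
    by (simp_all add: matrix_mul_assoc matrix_vector_mul_assoc)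
qed

lemma matrix_inv_unique_right:
  fixes S :: "real^'n^'n"
  assumes "S ** T = mat 1" shows "invertible S" "matrix_inv S = T"
proof -
  show i: "invertible S" using assms invertible_right_inverse by blast
  show "matrix_inv S = T" using matrix_inv_cancel(3)[OF i, of T] by (simp add: assms)
qed

lemma transpose_matrix_inv:
  fixes S :: "real^'n^'n"
  assumes "invertible S" shows "transpose (matrix_inv S) = matrix_inv (transpose S)"
proof -
  have "transpose S ** transpose (matrix_inv S) = mat 1"
    by (metis assms matrix_inv_cancel(1) matrix_transpose_mul transpose_mat)
  then show ?thesis using matrix_inv_unique_right(2) by metis
qed

lemma matrix_inv_mult:
  fixes S T :: "real^'n^'n"
  assumes "invertible S" "invertible T"
  shows "matrix_inv (S ** T) = matrix_inv T ** matrix_inv S"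
  by (rule matrix_inv_unique_right)
     (simp add: assms matrix_inv_cancel flip: matrix_mul_assoc)

lemma matrix_inv_matrix_inv: "invertible S \<Longrightarrow> matrix_inv (matrix_inv S) = (S :: real^'n^'n)"
  by (simp add: matrix_inv_cancel(1) matrix_inv_unique_right(2))

lemma continuous_det:
  fixes F :: "'a::t2_space \<Rightarrow> real^'n^'n"
  assumes "continuous net F" shows "continuous net (\<lambda>s. det (F s))"
  unfolding det_def by (intro continuous_intros assms)

text \<open>
  Cramer's rule: the entries of the inverse are quotients of polynomials in the entries of the matrix.
  This is the source of the continuity of matrix inversion.
\<close>

lemma matrix_inv_component:
  fixes S :: "real^'n^'n"
  assumes "invertible S"
  shows "matrix_inv S $ i $ j
    = det (\<chi> a b. if b = i then axis j 1 $ a else S $ a $ b) / det S"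
proof -
  have "S *v (matrix_inv S *v axis j 1) = axis j 1" by (simp add: assms matrix_inv_cancel)
  then have "matrix_inv S *v axis j 1
      = (\<chi> k. det (\<chi> a b. if b = k then axis j 1 $ a else S $ a $ b) / det S)"
    using assms by (subst (asm) cramer) (simp_all add: invertible_det_nz)
  then have "(matrix_inv S *v axis j 1) $ i
      = det (\<chi> a b. if b = i then axis j 1 $ a else S $ a $ b) / det S" by simp
  then show ?thesis by (simp add: matrix_vector_mult_basis column_def)
qed

lemma eventually_invertible:
  fixes F :: "real \<Rightarrow> real^'n^'n"
  assumes "continuous (at t) F" "invertible (F t)"
  shows "\<forall>\<^sub>F s in nhds t. invertible (F s)"
proof -
  have "((\<lambda>s. det (F s)) \<longlongrightarrow> det (F t)) (at t)"
    using continuous_det[OF assms(1)] by (simp add: continuous_at)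
  then have "\<forall>\<^sub>F s in at t. det (F s) \<noteq> 0"
    using assms(2) by (intro tendsto_imp_eventually_ne) (auto simp: invertible_det_nz)
  then show ?thesis
    using assms(2) by (auto simp: eventually_nhds_conv_at invertible_det_nz)
qed

lemma continuous_matrix_inv:
  fixes F :: "real \<Rightarrow> real^'n^'n"
  assumes "continuous (at t) F" "invertible (F t)"
  shows "continuous (at t) (\<lambda>s. matrix_inv (F s))"
proof -
  let ?C = "\<lambda>s. (\<chi> i j. det (\<chi> a b. if b = i then axis j 1 $ a else F s $ a $ b) / det (F s)) :: real^'n^'n"
  have *: "matrix_inv (F s) = ?C s" if "invertible (F s)" for s
    using that by (simp add: vec_eq_iff matrix_inv_component)
  have "((\<lambda>s. (\<chi> a b. if b = i then c a else F s $ a $ b) :: real^'n^'n)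
      \<longlongrightarrow> (\<chi> a b. if b = i then c a else F t $ a $ b)) (at t)" for i c
    using assms(1) by (intro vec_tendstoI) (auto simp: continuous_at intro!: tendsto_vec_nth)
  then have minor: "((\<lambda>s. det (\<chi> a b. if b = i then c a else F s $ a $ b :: real^'n^'n))
      \<longlongrightarrow> det (\<chi> a b. if b = i then c a else F t $ a $ b)) (at t)" for i c
    using continuous_det[of "at t" "\<lambda>s. (\<chi> a b. if b = i then c a else F s $ a $ b)"]
    by (simp add: continuous_at)
  have "((\<lambda>s. det (F s)) \<longlongrightarrow> det (F t)) (at t)"
    using continuous_det[OF assms(1)] by (simp add: continuous_at)
  moreover have "det (F t) \<noteq> 0" using assms(2) by (simp add: invertible_det_nz)
  ultimately have "isCont ?C t"
    unfolding continuous_at by (intro vec_tendstoI) (simp, intro tendsto_divide minor)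
  moreover have "\<forall>\<^sub>F s in nhds t. matrix_inv (F s) = ?C s"
    using eventually_invertible[OF assms] by eventually_elim (rule *)
  ultimately show ?thesis by (subst isCont_cong)
qed

lemma has_vector_derivative_iff_tendsto:
  "(f has_vector_derivative f') (at t) \<longleftrightarrow>
    ((\<lambda>s. (1 / (s - t)) *\<^sub>R (f s - f t)) \<longlongrightarrow> f') (at t)"
proof -
  have "norm (f s - f t - (s - t) *\<^sub>R f') / norm (s - t)
      = norm ((1 / (s - t)) *\<^sub>R (f s - f t) - f')" if "s \<noteq> t" for s
  proof -
    have "(1 / (s - t)) *\<^sub>R (f s - f t) - f' = (1 / (s - t)) *\<^sub>R (f s - f t - (s - t) *\<^sub>R f')"
      using that by (simp add: scaleR_diff_right)
    then show ?thesis by (simp add: divide_inverse mult.commute abs_inverse)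
  qed
  then have "(f has_vector_derivative f') (at t) \<longleftrightarrow>
      ((\<lambda>s. norm ((1 / (s - t)) *\<^sub>R (f s - f t) - f')) \<longlongrightarrow> 0) (at t)"
    unfolding has_vector_derivative_def has_derivative_iff_norm
    by (subst Lim_cong_within[OF refl refl refl, where g = "\<lambda>s. norm ((1 / (s - t)) *\<^sub>R (f s - f t) - f')"])
      (simp_all add: bounded_linear_scaleR_left)
  then show ?thesis by (simp add: tendsto_norm_zero_iff LIM_zero_iff)
qed

text \<open>
  The identity \<open>P\<^sup>-\<^sup>1 - Q\<^sup>-\<^sup>1 = - P\<^sup>-\<^sup>1 (P - Q) Q\<^sup>-\<^sup>1\<close> expresses the difference quotient of the inverse
  through that of the matrix, so continuity of the inverse already implies differentiability.
\<close>

lemma has_vector_derivative_matrix_inv: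
  fixes F :: "real \<Rightarrow> real^'n^'n"
  assumes F: "(F has_vector_derivative F') (at t)" and i: "invertible (F t)"
  shows "((\<lambda>s. matrix_inv (F s)) has_vector_derivative
    - (matrix_inv (F t) ** F' ** matrix_inv (F t))) (at t)"
proof -
  let ?q = "\<lambda>s. (1 / (s - t)) *\<^sub>R (F s - F t)"
  have cF: "continuous (at t) F" using F has_vector_derivative_continuous by blast
  have "((\<lambda>s. - (matrix_inv (F s) ** ?q s ** matrix_inv (F t)))
      \<longlongrightarrow> - (matrix_inv (F t) ** F' ** matrix_inv (F t))) (at t)"
  proof (intro tendsto_minus bounded_bilinear.tendsto[OF bounded_bilinear_matrix_mult] tendsto_const)
    show "((\<lambda>s. matrix_inv (F s)) \<longlongrightarrow> matrix_inv (F t)) (at t)"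
      using continuous_matrix_inv[OF cF i] by (simp add: continuous_at)
    show "(?q \<longlongrightarrow> F') (at t)"
      using F by (simp add: has_vector_derivative_iff_tendsto) 
  qed
  moreover have "\<forall>\<^sub>F s in at t. - (matrix_inv (F s) ** ?q s ** matrix_inv (F t))
      = (1 / (s - t)) *\<^sub>R (matrix_inv (F s) - matrix_inv (F t))"
    using eventually_invertible[OF cF i, THEN eventually_nhds_conv_at[THEN iffD1, THEN conjunct1]]
    by eventually_elim
      (simp add: mm_simps matrix_inv_cancel i
        flip: matrix_mul_assoc scaleR_minus_right)
  ultimately show ?thesis
    by (simp add: has_vector_derivative_iff_tendsto tendsto_cong)
qed

section \<open>Linear differential equations\<close>

text \<open>
  Gronwall's argument: \<open>exp (- 2 K t) |D t|\<^sup>2\<close> cannot increase, and it starts at \<open>0\<close>.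
\<close>

lemma vanishes_if_derivative_norm_le:
  fixes D :: "real \<Rightarrow> 'a::real_inner"
  assumes D: "\<And>t. a \<le> t \<Longrightarrow> t \<le> b \<Longrightarrow> (D has_vector_derivative D' t) (at t)"
    and K: "\<And>t. a \<le> t \<Longrightarrow> t \<le> b \<Longrightarrow> norm (D' t) \<le> K * norm (D t)"
    and "a \<le> b" "D a = 0"
  shows "D b = 0"
proof -
  define h where "h t = exp (- (2 * K * t)) * (D t \<bullet> D t)" for t
  have "h b \<le> h a"
  proof (rule DERIV_nonpos_imp_nonincreasing[OF \<open>a \<le> b\<close>])
    fix t assume t: "a \<le> t" "t \<le> b"
    have "(h has_real_derivative exp (- (2 * K * t)) * (2 * (D t \<bullet> D' t) - 2 * K * (D t \<bullet> D t))) (at t)"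
    proof -
      have "((\<lambda>t. D t \<bullet> D t) has_real_derivative D t \<bullet> D' t + D' t \<bullet> D t) (at t)"
        unfolding has_real_derivative_iff_has_vector_derivative
        by (rule bounded_bilinear.has_vector_derivative[OF bounded_bilinear_inner D[OF t] D[OF t]])
      moreover have "((\<lambda>t. exp (- (2 * K * t))) has_real_derivative exp (- (2 * K * t)) * (- (2 * K))) (at t)"
        by (auto intro!: derivative_eq_intros)
      ultimately show ?thesis
        unfolding h_def by (auto intro!: derivative_eq_intros simp: algebra_simps inner_commute)
    qed
    moreover have "D t \<bullet> D' t \<le> norm (D t) * (K * norm (D t))"
      using K[OF t] norm_cauchy_schwarz[of "D t" "D' t"] by (meson mult_left_mono norm_ge_zero order_trans)
    then have "exp (- (2 * K * t)) * (2 * (D t \<bullet> D' t) - 2 * K * (D t \<bullet> D t)) \<le> 0"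
      by (intro mult_nonneg_nonpos) (auto simp: dot_square_norm power2_eq_square algebra_simps)
    ultimately show "\<exists>y. (h has_real_derivative y) (at t) \<and> y \<le> 0" by blast
  qed
  then have "exp (- (2 * K * b)) * (D b \<bullet> D b) \<le> 0" by (simp add: h_def assms)
  then have "D b \<bullet> D b \<le> 0" by (simp add: mult_le_0_iff not_le)
  then show ?thesis by (metis inner_eq_zero_iff inner_ge_zero order_antisym)
qed

lemma has_vector_derivative_affine_reparam:
  assumes "(f has_vector_derivative f') (at (a * t + b))"
  shows "((\<lambda>t. f (a * t + b)) has_vector_derivative a *\<^sub>R f') (at t)"
proof -
  have "((\<lambda>t. a * t + b) has_vector_derivative a) (at t)"
    by (auto intro!: derivative_eq_intros)
  from vector_diff_chain_at[OF this assms] show ?thesis by (simp add: o_def)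
qed

text \<open>
  Identities between matrix functions are proved below by applying this to the difference of the two
  sides, once both are seen to solve the same linear differential equation.
\<close>

lemma linear_ode_zero:
  fixes D :: "real \<Rightarrow> 'a::real_inner"
  assumes L: "bounded_linear L"
    and D: "\<And>t. (D has_vector_derivative L (D t)) (at t)" and "D 0 = 0"
  shows "D t = 0"
proof -
  obtain K where K: "\<And>x. norm (L x) \<le> norm x * K"
    using bounded_linear.bounded[OF L] by blast
  show ?thesis
  proof (cases "0 \<le> t")
    case True
    show ?thesis
      by (rule vanishes_if_derivative_norm_le[where D = D and K = K and a = 0, OF D])
        (use K assms True in \<open>auto simp: mult.commute\<close>)
  next
    case False
    have "((\<lambda>s. D (- s)) has_vector_derivative - L (D (- s))) (at s)" for s
      using has_vector_derivative_affine_reparam[where a = "-1" and b = 0, of D _ s] D by simp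
    then have "D (- (- t)) = 0"
      by (rule vanishes_if_derivative_norm_le[where D = "\<lambda>s. D (- s)" and K = K and a = 0])
        (use K assms False in \<open>auto simp: mult.commute\<close>)
    then show ?thesis by simp
  qed
qed

text \<open>
  The exponential series of \<open>t L\<close>, applied to the vector \<open>x\<close>.
\<close>

definition linear_flow :: "('a::real_normed_vector \<Rightarrow> 'a) \<Rightarrow> 'a \<Rightarrow> real \<Rightarrow> 'a" where
  "linear_flow L x t = (\<Sum>k. (t ^ k / fact k) *\<^sub>R (L ^^ k) x)"

lemma summable_linear_flow:
  fixes L :: "'a::banach \<Rightarrow> 'a"
  assumes L: "bounded_linear L"
  shows "summable (\<lambda>k. (t ^ k / fact k) *\<^sub>R (L ^^ k) x)"
proof -
  obtain K where K: "0 < K" "\<And>x. norm (L x) \<le> norm x * K"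
    using bounded_linear.pos_bounded[OF L] by blast
  have pow: "norm ((L ^^ k) x) \<le> K ^ k * norm x" for k
  proof (induction k)
    case (Suc k)
    have "norm ((L ^^ Suc k) x) \<le> norm ((L ^^ k) x) * K" using K(2) by simp
    also have "\<dots> \<le> K ^ Suc k * norm x" using Suc K(1) by (simp add: mult.commute mult.left_commute)
    finally show ?case .
  qed simp
  show ?thesis
  proof (rule summable_comparison_test')
    show "summable (\<lambda>k. ((\<bar>t\<bar> * K) ^ k /\<^sub>R fact k) * norm x)"
      by (intro summable_mult2 summable_exp_generic)
    show "norm ((t ^ k / fact k) *\<^sub>R (L ^^ k) x) \<le> ((\<bar>t\<bar> * K) ^ k /\<^sub>R fact k) * norm x" for k
      using mult_left_mono[OF pow[of k], of "\<bar>t\<bar> ^ k / fact k"]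
      by (simp add: abs_mult power_abs power_mult_distrib divide_inverse mult_ac)
  qed
qed

text \<open>
  Each coordinate is a power series in the time, so it can be differentiated term by term.
\<close>

lemma has_vector_derivative_linear_flow:
  fixes L :: "'a::euclidean_space \<Rightarrow> 'a"
  assumes L: "bounded_linear L"
  shows "(linear_flow L x has_vector_derivative L (linear_flow L x t)) (at t)"
proof -
  have coord: "(\<Sum>k. ((L ^^ k) y \<bullet> b / fact k) * s ^ k) = linear_flow L y s \<bullet> b" for y b s
    unfolding linear_flow_def
    using bounded_linear.suminf[OF bounded_linear_inner_left summable_linear_flow[OF L, of s y], of b]
    by (simp add: mult_ac)
  have sum: "summable (\<lambda>k. ((L ^^ k) y \<bullet> b / fact k) * s ^ k)" for y b s
    using bounded_linear.summable[OF bounded_linear_inner_left summable_linear_flow[OF L, of s y], of b]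
    by (simp add: mult_ac)
  have shift: "linear_flow L (L x) t = L (linear_flow L x t)"
    unfolding linear_flow_def
    by (subst bounded_linear.suminf[OF L summable_linear_flow[OF L]])
      (simp add: linear_scale[OF bounded_linear.linear[OF L]] funpow_swap1)
  have "((\<lambda>s. linear_flow L x s \<bullet> b) has_real_derivative L (linear_flow L x t) \<bullet> b) (at t)" for b
  proof -
    have "diffs (\<lambda>k. (L ^^ k) x \<bullet> b / fact k) = (\<lambda>k. (L ^^ k) (L x) \<bullet> b / fact k)"
      by (auto simp: diffs_def fun_eq_iff funpow_swap1 fact_Suc simp del: of_nat_Suc)
    with termdiffs_strong_converges_everywhere[OF sum, of x b t]
    show ?thesis by (simp only: coord shift)
  qed
  then show ?thesis
    unfolding has_vector_derivative_def
    by (subst has_derivative_componentwise_within)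
      (auto simp: has_field_derivative_def mult_commute_abs)
qed

lemma linear_flow_0: "linear_flow L x 0 = x"
  unfolding linear_flow_def by (subst suminf_finite[of "{0}"]) auto

section \<open>The matrix exponential and the matrix hyperbolic functions\<close>

lemmas has_vector_derivative_matrix_mult =
  bounded_bilinear.has_vector_derivative[OF bounded_bilinear_matrix_mult]
lemmas has_vector_derivative_matrix_vector_mult =
  bounded_bilinear.has_vector_derivative[OF bounded_bilinear_matrix_vector_mult]
lemmas has_vector_derivative_transpose =
  bounded_linear.has_vector_derivative[OF bounded_linear_transpose]
lemmas bounded_linear_matrix_mult_right =
  bounded_bilinear.bounded_linear_right[OF bounded_bilinear_matrix_mult]
lemmas bounded_linear_matrix_mult_left =
  bounded_bilinear.bounded_linear_left[OF bounded_bilinear_matrix_mult]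

lemma matrix_exp_scaleR:
  fixes B :: "real^'d^'d"
  shows "matrix_exp (t *\<^sub>R B) = linear_flow ((**) B) (mat 1) t"
proof -
  have "((**) (t *\<^sub>R B) ^^ k) X = t ^ k *\<^sub>R ((**) B ^^ k) X" for k and X :: "real^'d^'d"
    by (induction k) (simp_all add: mm_simps mult.commute)
  then show ?thesis by (simp add: matrix_exp_def linear_flow_def)
qed

lemma has_vector_derivative_matrix_exp:
  "((\<lambda>t. matrix_exp (t *\<^sub>R B)) has_vector_derivative B ** matrix_exp (t *\<^sub>R B)) (at t)"
  using has_vector_derivative_linear_flow[OF bounded_linear_matrix_mult_right, of B "mat 1" t]
  by (simp add: matrix_exp_scaleR)

lemma matrix_exp_0: "matrix_exp 0 = mat 1"
  using matrix_exp_scaleR[of 0 0] by (simp add: linear_flow_0)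

lemma matrix_exp_commute: "matrix_exp (t *\<^sub>R B) ** B = B ** matrix_exp (t *\<^sub>R B)"
proof -
  have "matrix_exp (t *\<^sub>R B) ** B - B ** matrix_exp (t *\<^sub>R B) = 0"
    by (rule linear_ode_zero[OF bounded_linear_matrix_mult_right[of B]])
      (rule derivative_eq_intros has_vector_derivative_matrix_exp has_vector_derivative_const
        has_vector_derivative_matrix_mult refl | simp add: mm_simps matrix_mul_assoc matrix_exp_0)+
  then show ?thesis by simp
qed

lemma matrix_exp_add: "matrix_exp ((s + t) *\<^sub>R B) = matrix_exp (s *\<^sub>R B) ** matrix_exp (t *\<^sub>R B)"
proof -
  have *: "((\<lambda>s. matrix_exp ((s + t) *\<^sub>R B)) has_vector_derivative B ** matrix_exp ((s + t) *\<^sub>R B)) (at s)" for s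
    using has_vector_derivative_affine_reparam[where a = 1 and b = t and t = s, OF has_vector_derivative_matrix_exp]
    by simp
  have "matrix_exp ((s + t) *\<^sub>R B) - matrix_exp (s *\<^sub>R B) ** matrix_exp (t *\<^sub>R B) = 0"
    by (rule linear_ode_zero[OF bounded_linear_matrix_mult_right[of B]])
      (rule derivative_eq_intros * has_vector_derivative_matrix_exp has_vector_derivative_const
        has_vector_derivative_matrix_mult refl | simp add: mm_simps matrix_mul_assoc matrix_exp_0)+
  then show ?thesis by simp
qed

lemma transpose_matrix_exp:
  assumes "sym_matrix B"
  shows "transpose (matrix_exp (t *\<^sub>R B)) = matrix_exp (t *\<^sub>R B)"
proof -
  have c: "B ** transpose (matrix_exp (t *\<^sub>R B)) = transpose (matrix_exp (t *\<^sub>R B)) ** B" for t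
    using matrix_exp_commute[of t B] assms unfolding sym_matrix_def by (metis matrix_transpose_mul)
  have "transpose (matrix_exp (t *\<^sub>R B)) - matrix_exp (t *\<^sub>R B) = 0"
    by (rule linear_ode_zero[OF bounded_linear_matrix_mult_right[of B]])
      (rule derivative_eq_intros has_vector_derivative_transpose has_vector_derivative_matrix_exp refl
      | use assms in \<open>simp add: mm_simps c matrix_transpose_mul matrix_exp_0 sym_matrix_def\<close>)+
  then show ?thesis by simp
qed

text \<open>
  The factorization that makes the exponential of a symmetric matrix positive definite.
\<close>

lemma matrix_exp_half_square:
  assumes "sym_matrix B"
  shows "matrix_exp (t *\<^sub>R B)
    = matrix_exp ((t / 2) *\<^sub>R B) ** transpose (matrix_exp ((t / 2) *\<^sub>R B))"
  using matrix_exp_add[of "t / 2" "t / 2" B] by (simp add: transpose_matrix_exp[OF assms])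

lemma invertible_matrix_exp: "invertible (matrix_exp (t *\<^sub>R B))"
  by (rule matrix_inv_unique_right(1)[where T = "matrix_exp ((- t) *\<^sub>R B)"])
    (use matrix_exp_add[of t "- t" B] in \<open>simp add: matrix_exp_0\<close>)

text \<open>
  The functions \<open>c t = cosh (t \<surd>M)\<close> and \<open>s t = sinh (t \<surd>M) / \<surd>M\<close>.  Their power series involve only
  integral powers of \<open>M\<close>, so they are obtained without a square root, as the flow of the linear system
  \<open>c' = M s\<close>, \<open>s' = c\<close>.
\<close>

lemma matrix_cosh_sinh_exist:
  fixes M :: "real^'d^'d"
  assumes M: "transpose M = M"
  obtains c s :: "real \<Rightarrow> real^'d^'d" where
    "\<And>t. (c has_vector_derivative M ** s t) (at t)" "\<And>t. (s has_vector_derivative c t) (at t)"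
    "c 0 = mat 1" "s 0 = 0"
    "\<And>t. transpose (c t) = c t" "\<And>t. transpose (s t) = s t"
    "\<And>t. c t ** M = M ** c t" "\<And>t. s t ** M = M ** s t" "\<And>t. s t ** c t = c t ** s t"
    "\<And>t. c t ** c t = mat 1 + M ** (s t ** s t)"
proof -
  let ?L = "\<lambda>x :: (real^'d^'d) \<times> (real^'d^'d). (M ** snd x, fst x)"
  have L: "bounded_linear ?L"
    by (intro bounded_linear_Pair bounded_linear_compose[OF bounded_linear_matrix_mult_right]
        bounded_linear_fst bounded_linear_snd)
  define F where "F = linear_flow ?L (mat 1, 0)"
  define c where "c t = fst (F t)" for t
  define s where "s t = snd (F t)" for t
  have F: "(F has_vector_derivative (M ** s t, c t)) (at t)" for t
    using has_vector_derivative_linear_flow[OF L, of "(mat 1, 0)" t] by (simp add: F_def c_def s_def)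
  have c': "(c has_vector_derivative M ** s t) (at t)" for t
    unfolding c_def[abs_def] using bounded_linear.has_vector_derivative[OF bounded_linear_fst F] by simp
  have s': "(s has_vector_derivative c t) (at t)" for t
    unfolding s_def[abs_def] using bounded_linear.has_vector_derivative[OF bounded_linear_snd F] by simp
  have 0: "c 0 = mat 1" "s 0 = 0" by (simp_all add: c_def s_def F_def linear_flow_0)
  note der = derivative_eq_intros c' s' has_vector_derivative_const has_vector_derivative_matrix_mult
    has_vector_derivative_transpose has_vector_derivative_Pair
  have "(c t ** M - M ** c t, s t ** M - M ** s t) = 0" for t
    by (rule linear_ode_zero[OF L]) (rule der refl | simp add: mm_simps matrix_mul_assoc 0 zero_prod_def)+
  then have cM: "c t ** M = M ** c t" and sM: "s t ** M = M ** s t" for t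
    by (simp_all add: prod_eq_iff)
  have sT: "M ** transpose (s t) = transpose (s t) ** M" for t
    using sM[of t] M by (metis matrix_transpose_mul)
  have "(transpose (c t) - c t, transpose (s t) - s t) = 0" for t
    by (rule linear_ode_zero[OF L])
      (rule der refl | simp add: zero_prod_def mm_simps 0 M sT matrix_transpose_mul transpose_linear_simps)+
  then have sym: "transpose (c t) = c t" "transpose (s t) = s t" for t
    by (simp_all add: prod_eq_iff)
  have zero: "bounded_linear (\<lambda>x. 0 :: real^'d^'d)" by (rule bounded_linear_zero)
  have "s t ** c t - c t ** s t = 0" for t
    by (rule linear_ode_zero[OF zero])
      (rule der refl | simp add: mm_simps matrix_mul_assoc 0 sM)+
  then have sc: "s t ** c t = c t ** s t" for t by simp
  have *: "s t ** (M ** X) = M ** (s t ** X)" "s t ** (c t ** X) = c t ** (s t ** X)" 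
    "c t ** (M ** X) = M ** (c t ** X)" for t X
    by (simp_all add: matrix_mul_assoc sM sc cM)
  have two: "M ** (2 * X) = 2 * (M ** X)" for X
    by (simp only: mult_2 mm_simps)
  have "c t ** c t - (mat 1 + M ** (s t ** s t)) = 0" for t
    by (rule linear_ode_zero[OF zero])
      (rule der refl | simp add: mm_simps 0 sc two * flip: matrix_mul_assoc)+
  then have "c t ** c t = mat 1 + M ** (s t ** s t)" for t by simp
  then show ?thesis using that c' s' 0 sym cM sM sc by blast
qed

section \<open>Positive definite matrices\<close>

lemma inner_transpose_mult: "(transpose A *v x) \<bullet> y = x \<bullet> ((A :: real^'n^'m) *v y)"
  by (simp add: dot_lmul_matrix)

lemma pos_def_invertible: "pos_def S \<Longrightarrow> invertible S"
proof -
  assume "pos_def S"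
  then have "x = 0" if "S *v x = 0" for x
    using that unfolding pos_def_def by force
  then show ?thesis by (simp add: invertible_left_inverse matrix_left_invertible_ker)
qed

lemma pos_def_mult_transpose:
  fixes P :: "real^'d^'d"
  assumes P: "invertible P"
  shows "pos_def (P ** transpose P)"
proof -
  have "x \<bullet> ((P ** transpose P) *v x) = (transpose P *v x) \<bullet> (transpose P *v x)" for x
    by (simp only: inner_transpose_mult matrix_vector_mul_assoc)
  moreover have "transpose P *v x \<noteq> 0" if "x \<noteq> 0" for x
    using matrix_inv_cancel(5)[OF transpose_invertible[OF P], of x] that by (metis matrix_vector_mult_0_right)
  ultimately show ?thesis
    by (auto simp: pos_def_def sym_matrix_def matrix_transpose_mul simp del: transpose_matrix_vector)
qed

lemma sym_matrix_matrix_inv: "invertible S \<Longrightarrow> sym_matrix S \<Longrightarrow> sym_matrix (matrix_inv S)"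
  by (simp add: sym_matrix_def transpose_matrix_inv)

lemma pos_def_matrix_inv: "pos_def S \<Longrightarrow> pos_def (matrix_inv S)"
proof -
  assume S: "pos_def S"
  note i = pos_def_invertible[OF S]
  have "0 < x \<bullet> (matrix_inv S *v x)" if "x \<noteq> 0" for x
  proof -
    let ?y = "matrix_inv S *v x"
    have "S *v ?y = x" by (simp add: matrix_inv_cancel[OF i])
    moreover from this have "?y \<noteq> 0" using that by auto
    ultimately show ?thesis using S by (metis inner_commute pos_def_def)
  qed
  then show ?thesis using S i sym_matrix_matrix_inv by (auto simp: pos_def_def)
qed

text \<open>
  The segment from the identity to \<open>S\<close> consists of positive definite, hence invertible, matrices, so the
  determinant cannot change sign along it.
\<close>

lemma pos_def_det_pos:
  assumes S: "pos_def S" shows "0 < det S"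
proof (rule ccontr)
  assume neg: "\<not> 0 < det S"
  define F where "F t = (1 - t) *\<^sub>R mat 1 + t *\<^sub>R S" for t :: real
  have "continuous (at t) F" for t unfolding F_def by (intro continuous_intros)
  then have "\<exists>t. 0 \<le> t \<and> t \<le> 1 \<and> det (F t) = 0"
    using neg by (intro IVT2 allI impI continuous_det) (auto simp: F_def)
  then obtain t where t: "0 \<le> t" "t \<le> 1" "det (F t) = 0" by blast
  have "pos_def (F t)"
    unfolding pos_def_def
  proof (intro conjI allI impI)
    show "sym_matrix (F t)"
      using S by (simp add: F_def sym_matrix_def pos_def_def transpose_linear_simps)
    fix x :: "real^'a" assume "x \<noteq> 0"
    then have "0 < x \<bullet> x" "0 < x \<bullet> (S *v x)" using S by (auto simp: pos_def_def)
    moreover have "x \<bullet> (F t *v x) = (1 - t) * (x \<bullet> x) + t * (x \<bullet> (S *v x))"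
      by (simp add: F_def mv_simps inner_add_right)
    ultimately show "0 < x \<bullet> (F t *v x)"
      using t by (cases "t = 0") (auto intro!: add_nonneg_pos)
  qed
  then show False using t pos_def_invertible by (auto simp: invertible_det_nz)
qed

section \<open>The geodesic equation of the twisted Fisher metric\<close>

lemma bounded_linear_trace: "bounded_linear (trace :: real^'n^'n \<Rightarrow> real)"
  unfolding linear_conv_bounded_linear[symmetric]
  by (auto intro!: linearI simp: trace_add trace_scaleR)

text \<open>
  The metric depends on the base point only through the inverse covariance \<open>J\<close>, whose derivative in the
  direction \<open>X\<close> is \<open>- J X J\<close>.
\<close>

lemma metric_deriv_twisted_fisher:
  fixes S :: "real^'d^'d"
  assumes i: "invertible S"
  defines "J \<equiv> matrix_inv S"
  shows "metric_deriv (twisted_fisher a b) (m, S) (u, X) (v, Y) (w, W)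
    = - (1 / a) * (v \<bullet> (J ** X ** J *v w))
      - 1 / (2 * b) * (trace (J ** X ** J ** Y ** J ** W) + trace (J ** Y ** J ** X ** J ** W))"
proof -
  let ?F = "\<lambda>t. matrix_inv (S + t *\<^sub>R X)"
  let ?F' = "- (J ** X ** J)"
  have "((\<lambda>t. S + t *\<^sub>R X) has_vector_derivative X) (at 0)"
    by (auto intro!: derivative_eq_intros)
  from has_vector_derivative_matrix_inv[OF this] i
  have F: "(?F has_vector_derivative ?F') (at 0)" by (simp add: J_def)
  have A: "((\<lambda>t. v \<bullet> (?F t *v w)) has_real_derivative v \<bullet> (?F' *v w)) (at 0)"
    unfolding has_real_derivative_iff_has_vector_derivative
    by (intro bounded_linear.has_vector_derivative[OF bounded_linear_inner_right]
      bounded_linear.has_vector_derivative[OF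
        bounded_bilinear.bounded_linear_left[OF bounded_bilinear_matrix_vector_mult]] F)
  have "((\<lambda>t. ?F t ** Y ** ?F t ** W) has_vector_derivative
      (J ** Y ** ?F' + ?F' ** Y ** J) ** W) (at 0)"
    by (rule has_vector_derivative_matrix_mult[THEN has_vector_derivative_eq_rhs] F 
        has_vector_derivative_const refl | simp add: J_def mm_simps)+
  then have B: "((\<lambda>t. trace (?F t ** Y ** ?F t ** W)) has_real_derivative
      trace ((J ** Y ** ?F' + ?F' ** Y ** J) ** W)) (at 0)"
    unfolding has_real_derivative_iff_has_vector_derivative
    by (rule bounded_linear.has_vector_derivative[OF bounded_linear_trace])
  from DERIV_add[OF DERIV_cmult[OF A, of "1 / a"] DERIV_cmult[OF B, of "1 / (2 * b)"]]
  have "((\<lambda>t. twisted_fisher a b ((m, S) + t *\<^sub>R (u, X)) (v, Y) (w, W)) has_real_derivative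
      1 / a * (v \<bullet> (?F' *v w)) + 1 / (2 * b) * trace ((J ** Y ** ?F' + ?F' ** Y ** J) ** W)) (at 0)"
    by (simp add: twisted_fisher_def)
  then show ?thesis
    unfolding metric_deriv_def
    by (subst DERIV_imp_deriv, assumption)
      (simp add: mv_simps mm_simps trace_sub trace_add matrix_mul_assoc algebra_simps
        linear_neg[OF bounded_linear.linear[OF bounded_linear_trace]])
qed

text \<open>
  Pairing \<open>(u, X)\<close> with \<open>(S u, S X S)\<close> gives a positive combination of \<open>u \<bullet> u\<close> and \<open>X \<bullet> X\<close>, so only the
  zero vector is orthogonal to the whole tangent space.
\<close>

lemma twisted_fisher_nondegenerate:
  fixes S :: "real^'d^'d"
  assumes ab: "a > 0" "b > 0" and S: "invertible S" "sym_matrix S" and X: "sym_matrix X" "sym_matrix X'"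
    and eq: "\<And>w. w \<in> gauss_tangent \<Longrightarrow>
      twisted_fisher a b (m, S) (u, X) w = twisted_fisher a b (m, S) (u', X') w"
  shows "(u, X) = (u', X')"
proof -
  define v Z where "v = u - u'" and "Z = X - X'"
  have Z: "transpose Z = Z" using X by (simp add: Z_def sym_matrix_def transpose_linear_simps)
  have "(S *v v, S ** Z ** S) \<in> gauss_tangent"
    using S Z by (simp add: gauss_tangent_def sym_matrix_def matrix_transpose_mul matrix_mul_assoc)
  from eq[OF this] have "twisted_fisher a b (m, S) (v, Z) (S *v v, S ** Z ** S) = 0"
    by (simp add: twisted_fisher_def v_def Z_def mm_simps trace_sub inner_diff_left algebra_simps)
      (simp add: diff_divide_distrib add_divide_distrib)
  then have "1 / a * (v \<bullet> v) + 1 / (2 * b) * trace (matrix_inv S ** Z ** Z ** S) = 0"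
    using S by (simp add: twisted_fisher_def matrix_inv_cancel flip: matrix_mul_assoc)
  also have "trace (matrix_inv S ** Z ** Z ** S) = Z \<bullet> Z"
    using S by (subst trace_mul_sym)
      (simp add: inner_matrix_eq_trace Z matrix_inv_cancel flip: matrix_mul_assoc)
  finally have "1 / a * (v \<bullet> v) + 1 / (2 * b) * (Z \<bullet> Z) = 0" .
  moreover have "0 \<le> 1 / a * (v \<bullet> v)" "0 \<le> 1 / (2 * b) * (Z \<bullet> Z)" using ab by auto
  ultimately have "1 / a * (v \<bullet> v) = 0" "1 / (2 * b) * (Z \<bullet> Z) = 0" by linarith+
  then show ?thesis using ab by (simp add: v_def Z_def)
qed

text \<open>
  Cyclic invariance of the trace turns the right-hand side of the Koszul formula into the pairing of
  \<open>w\<close> with the vector below; nondegeneracy of the metric makes this vector the only candidate.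
\<close>

lemma christoffel_twisted_fisher:
  fixes S :: "real^'d^'d"
  assumes ab: "a > 0" "b > 0" and S: "pos_def S" and X: "sym_matrix X"
  shows "christoffel gauss_tangent (twisted_fisher a b) (m, S) (u, X) (u, X)
    = (- (X ** matrix_inv S *v u), (b / a) *\<^sub>R outer u u - X ** matrix_inv S ** X)"
    (is "_ = ?z")
proof -
  define J where "J = matrix_inv S"
  have i: "invertible S" and sS: "sym_matrix S"
    using S pos_def_invertible by (auto simp: pos_def_def)
  have J: "transpose J = J" and X': "transpose X = X"
    using sym_matrix_matrix_inv[OF i sS] X by (simp_all add: J_def sym_matrix_def)
  have zV: "?z \<in> gauss_tangent"
    using J X' by (simp add: gauss_tangent_def sym_matrix_def transpose_linear_simps transpose_outer
        matrix_transpose_mul matrix_mul_assoc flip: J_def)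
  have z: "2 * twisted_fisher a b (m, S) ?z w
      = metric_deriv (twisted_fisher a b) (m, S) (u, X) (u, X) w
        + metric_deriv (twisted_fisher a b) (m, S) (u, X) (u, X) w
        - metric_deriv (twisted_fisher a b) (m, S) w (u, X) (u, X)" for w
  proof -
    obtain w1 W where w: "w = (w1, W)" by fastforce
    have 1: "u \<bullet> (J ** X ** J *v w1) = (X ** J *v u) \<bullet> (J *v w1)"
      using inner_transpose_mult[of "J ** X" u "J *v w1"] J X'
      by (simp add: matrix_transpose_mul matrix_vector_mul_assoc matrix_mul_assoc del: transpose_matrix_vector)
    have 2: "trace (J ** outer u u ** J ** W) = u \<bullet> (J ** W ** J *v u)"
      using trace_mul_sym[of J "outer u u ** J ** W"] trace_mul_sym[of "outer u u" "J ** W ** J"]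
      by (simp add: inner_eq_trace_outer matrix_mul_assoc)
    have 3: "trace (J ** W ** J ** X ** J ** X) = trace (J ** X ** J ** X ** J ** W)"
      using trace_mul_sym[of "J ** W" "J ** X ** J ** X"] by (simp add: matrix_mul_assoc)
    have 4: "trace (J ** X ** J ** W ** J ** X) = trace (J ** X ** J ** X ** J ** W)"
      using trace_mul_sym[of "J ** X ** J ** W" "J ** X"] by (simp add: matrix_mul_assoc)
    have "J ** ((b / a) *\<^sub>R outer u u - X ** J ** X) ** J ** W
        = (b / a) *\<^sub>R (J ** outer u u ** J ** W) - J ** X ** J ** X ** J ** W"
      by (simp add: mm_simps matrix_mul_assoc)
    then have 5: "trace (J ** ((b / a) *\<^sub>R outer u u - X ** J ** X) ** J ** W)
        = b / a * (u \<bullet> (J ** W ** J *v u)) - trace (J ** X ** J ** X ** J ** W)"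
      by (simp add: trace_sub trace_scaleR 2)
    show ?thesis
      unfolding w metric_deriv_twisted_fisher[OF i]
      using ab by (simp add: twisted_fisher_def 1 3 4 5 field_simps flip: J_def)
  qed
  show ?thesis
    unfolding christoffel_def
  proof (rule the_equality)
    fix y assume y: "y \<in> gauss_tangent \<and> (\<forall>w\<in>gauss_tangent. 2 * twisted_fisher a b (m, S) y w
      = metric_deriv (twisted_fisher a b) (m, S) (u, X) (u, X) w
        + metric_deriv (twisted_fisher a b) (m, S) (u, X) (u, X) w
        - metric_deriv (twisted_fisher a b) (m, S) w (u, X) (u, X))"
    obtain y1 Y where [simp]: "y = (y1, Y)" by fastforce
    have "twisted_fisher a b (m, S) (y1, Y) w = twisted_fisher a b (m, S) ?z w"
      if "w \<in> gauss_tangent" for w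
      using y z[of w] that by auto
    moreover have "sym_matrix Y" using y by (simp add: gauss_tangent_def)
    moreover have "sym_matrix (snd ?z)" using zV by (simp add: gauss_tangent_def)
    ultimately show "y = ?z"
      unfolding \<open>y = (y1, Y)\<close> snd_conv
      by (intro twisted_fisher_nondegenerate[OF ab i sS, where m = m]) auto
  qed (use zV z in blast)
qed

text \<open>
  The geodesic equation written out for the mean \<open>m\<close> and the covariance \<open>S\<close>:
  \<open>m'' = S' S\<^sup>-\<^sup>1 m'\<close> and \<open>S'' = S' S\<^sup>-\<^sup>1 S' - k m' m'\<^sup>T\<close>.  The two scaling factors of the metric
  enter only through their quotient \<open>k = \<eta>\<^sub>\<Sigma> / \<eta>\<^sub>\<mu>\<close>.
\<close>

definition fisher_geodesic where
  "fisher_geodesic k I m S m' S' \<longleftrightarrow> (\<forall>t\<in>I. pos_def (S t)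
     \<and> (m has_vector_derivative m' t) (at t) \<and> (S has_vector_derivative S' t) (at t)
     \<and> (m' has_vector_derivative S' t ** matrix_inv (S t) *v m' t) (at t)
     \<and> (S' has_vector_derivative S' t ** matrix_inv (S t) ** S' t - k *\<^sub>R outer (m' t) (m' t)) (at t))"

lemma has_vector_derivative_fst_snd_iff:
  "(c has_vector_derivative c') (at t) \<longleftrightarrow>
    ((\<lambda>t. fst (c t)) has_vector_derivative fst c') (at t)
    \<and> ((\<lambda>t. snd (c t)) has_vector_derivative snd c') (at t)"
  using has_vector_derivative_Pair[of "\<lambda>t. fst (c t)" "fst c'" t UNIV "\<lambda>t. snd (c t)" "snd c'"]
    bounded_linear.has_vector_derivative[OF bounded_linear_fst, of c c' "at t"]
    bounded_linear.has_vector_derivative[OF bounded_linear_snd, of c c' "at t"]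
  by auto

lemma sym_matrix_has_vector_derivative:
  assumes "open I" "t \<in> I" "\<And>s. s \<in> I \<Longrightarrow> sym_matrix (S s)" "(S has_vector_derivative S') (at t)"
  shows "sym_matrix S'"
proof -
  have "((\<lambda>s. transpose (S s)) has_vector_derivative transpose S') (at t)"
    using assms(4) by (rule has_vector_derivative_transpose)
  then have "(S has_vector_derivative transpose S') (at t)"
    by (rule has_vector_derivative_transform_within_open[OF _ assms(1,2)])
      (use assms(3) in \<open>auto simp: sym_matrix_def\<close>)
  then show ?thesis
    using vector_derivative_unique_at assms(4) by (auto simp: sym_matrix_def)
qed

text \<open>
  The Christoffel symbol is known only on tangent vectors.  Since \<open>I\<close> is open, the velocity of a curve of
  symmetric matrices is symmetric, so this is no restriction along a curve in the manifold.
\<close>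

lemma is_geodesic_iff_fisher_geodesic:
  assumes ab: "a > 0" "b > 0" and "open I"
  shows "is_geodesic gauss_tangent gauss_params (twisted_fisher a b) I c c'
    \<longleftrightarrow> fisher_geodesic (b / a) I (\<lambda>t. fst (c t)) (\<lambda>t. snd (c t)) (\<lambda>t. fst (c' t)) (\<lambda>t. snd (c' t))"
proof -
  have pd: "pos_def (snd p)" if "p \<in> gauss_params" for p :: "(real^'a) \<times> (real^'a^'a)"
    using that by (auto simp: gauss_params_def)
  have main: "(c t \<in> gauss_params \<and> (c has_vector_derivative c' t) (at t)
        \<and> (c' has_vector_derivative - christoffel gauss_tangent (twisted_fisher a b) (c t) (c' t) (c' t)) (at t))
    \<longleftrightarrow> (pos_def (snd (c t))
     \<and> ((\<lambda>t. fst (c t)) has_vector_derivative fst (c' t)) (at t)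
     \<and> ((\<lambda>t. snd (c t)) has_vector_derivative snd (c' t)) (at t)
     \<and> ((\<lambda>t. fst (c' t)) has_vector_derivative snd (c' t) ** matrix_inv (snd (c t)) *v fst (c' t)) (at t)
     \<and> ((\<lambda>t. snd (c' t)) has_vector_derivative snd (c' t) ** matrix_inv (snd (c t)) ** snd (c' t)
          - (b / a) *\<^sub>R outer (fst (c' t)) (fst (c' t))) (at t))"
    if "sym_matrix (snd (c' t))" for t
  proof (cases "pos_def (snd (c t))")
    case True
    then show ?thesis
      using christoffel_twisted_fisher[OF ab True that, of "fst (c t)" "fst (c' t)"]
      by (auto simp: gauss_params_def mem_Times_iff has_vector_derivative_fst_snd_iff[of c] has_vector_derivative_fst_snd_iff[of c'])
  qed (auto dest: pd)
  have symm: "sym_matrix (snd (c' t))"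
    if "t \<in> I" "\<And>s. s \<in> I \<Longrightarrow> pos_def (snd (c s))" "((\<lambda>t. snd (c t)) has_vector_derivative snd (c' t)) (at t)" for t
    using that sym_matrix_has_vector_derivative[OF \<open>open I\<close>, of t "\<lambda>t. snd (c t)"] by (auto simp: pos_def_def)
  show ?thesis (is "?L \<longleftrightarrow> ?R")
  proof
    assume L: ?L
    then have "sym_matrix (snd (c' t))" if "t \<in> I" for t
      using that by (intro symm) (auto simp: is_geodesic_def has_vector_derivative_fst_snd_iff[of c] dest: pd)
    then show ?R using L main by (simp add: is_geodesic_def fisher_geodesic_def)
  next
    assume R: ?R
    then have "sym_matrix (snd (c' t))" if "t \<in> I" for t
      using that by (intro symm) (auto simp: fisher_geodesic_def)
    then show ?L using R main by (simp add: is_geodesic_def fisher_geodesic_def)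
  qed
qed

section \<open>Geodesics are determined by their initial position and velocity\<close>

lemma constant_if_derivative_zero:
  assumes "\<And>s. s \<in> {0..1::real} \<Longrightarrow> (f has_vector_derivative 0) (at s)" and t: "t \<in> {0..1}"
  shows "f t = f 0"
proof -
  have "\<And>s. s \<in> {0..1} \<Longrightarrow> (f has_vector_derivative 0) (at s within {0..1})"
    using assms(1) has_vector_derivative_at_within by blast
  then obtain c where "\<And>s. s \<in> {0..1} \<Longrightarrow> f s = c"
    using has_vector_derivative_zero_constant[of "{0..1}" f] by auto
  then show ?thesis using t by simp
qed

text \<open>
  Conserved quantities: translations and linear changes of coordinates are isometries, and they make
  \<open>p = S\<^sup>-\<^sup>1 m'\<close> and \<open>C = S\<^sup>-\<^sup>1 S' + k p m\<^sup>T\<close> constant along geodesics.  They reduce the geodesic equation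
  to a first-order system that is polynomial in \<open>(m, S)\<close>.
\<close>

lemma fisher_geodesic_first_integrals:
  fixes S :: "real \<Rightarrow> real^'d^'d"
  assumes geo: "fisher_geodesic k I m S m' S'" and I: "{0..1} \<subseteq> I"
    and p: "p = matrix_inv (S 0) *v m' 0"
    and C: "C = matrix_inv (S 0) ** S' 0 + k *\<^sub>R outer p (m 0)"
    and t: "t \<in> {0..1}"
  shows "m' t = S t *v p" "S' t = S t ** (C - k *\<^sub>R outer p (m t))"
proof -
  have geo': "pos_def (S t)" "(m has_vector_derivative m' t) (at t)" "(S has_vector_derivative S' t) (at t)"
    "(m' has_vector_derivative S' t ** matrix_inv (S t) *v m' t) (at t)"
    "(S' has_vector_derivative S' t ** matrix_inv (S t) ** S' t - k *\<^sub>R outer (m' t) (m' t)) (at t)"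
    if "t \<in> {0..1}" for t
    using that geo I unfolding fisher_geodesic_def by blast+
  note inv = pos_def_invertible[OF geo'(1)]
  have p_const: "matrix_inv (S t) *v m' t = p" if "t \<in> {0..1}" for t
    unfolding p
  proof (rule constant_if_derivative_zero[OF _ that])
    fix t :: real assume t: "t \<in> {0..1}"
    show "((\<lambda>t. matrix_inv (S t) *v m' t) has_vector_derivative 0) (at t)"
      by (rule has_vector_derivative_matrix_vector_mult[OF
            has_vector_derivative_matrix_inv[OF geo'(3)[OF t] inv[OF t]] geo'(4)[OF t],
            THEN has_vector_derivative_eq_rhs])
        (simp add: mv_simps matrix_vector_mul_assoc matrix_mul_assoc)
  qed
  have "matrix_inv (S t) ** S' t + k *\<^sub>R outer p (m t)
      = matrix_inv (S 0) ** S' 0 + k *\<^sub>R outer p (m 0)"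
  proof (rule constant_if_derivative_zero[OF _ t])
    fix t :: real assume t: "t \<in> {0..1}"
    have "((\<lambda>t. matrix_inv (S t) ** S' t) has_vector_derivative
        - (k *\<^sub>R outer p (m' t))) (at t)"
      by (rule has_vector_derivative_matrix_mult[OF
            has_vector_derivative_matrix_inv[OF geo'(3)[OF t] inv[OF t]] geo'(5)[OF t],
            THEN has_vector_derivative_eq_rhs])
        (simp add: mm_simps mult_outer p_const[OF t] matrix_mul_assoc)
    moreover have "((\<lambda>t. k *\<^sub>R outer p (m t)) has_vector_derivative k *\<^sub>R outer p (m' t)) (at t)"
      by (intro bounded_linear.has_vector_derivative[OF bounded_linear_scaleR_right]
          bounded_linear.has_vector_derivative[OF
            bounded_bilinear.bounded_linear_right[OF bounded_bilinear_outer]] geo'(2)[OF t])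
    ultimately show "((\<lambda>t. matrix_inv (S t) ** S' t + k *\<^sub>R outer p (m t)) has_vector_derivative 0) (at t)"
      by (rule has_vector_derivative_add[THEN has_vector_derivative_eq_rhs]) simp
  qed
  then have "matrix_inv (S t) ** S' t = C - k *\<^sub>R outer p (m t)" by (simp add: C algebra_simps)
  then show "S' t = S t ** (C - k *\<^sub>R outer p (m t))"
    using matrix_inv_cancel(4)[OF inv[OF t], of "S' t"] by simp
  show "m' t = S t *v p"
    using matrix_inv_cancel(6)[OF inv[OF t], of "m' t"] p_const[OF t] by simp
qed

lemma bounded_norm_on_compact_interval:
  assumes "\<And>t. t \<in> {a..b} \<Longrightarrow> (f has_vector_derivative f' t) (at t)"
  obtains K where "0 \<le> K" "\<And>t. t \<in> {a..b::real} \<Longrightarrow> norm (f t) \<le> K"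
proof -
  have "compact (f ` {a..b})"
    by (intro compact_continuous_image continuous_at_imp_continuous_on ballI compact_Icc
        has_vector_derivative_continuous[OF assms])
  then obtain K where "0 < K" "\<forall>x\<in>f ` {a..b}. norm x \<le> K"
    using compact_imp_bounded bounded_pos by blast
  then show ?thesis using that[of K] by auto
qed

text \<open>
  Both geodesics have the same constants \<open>p\<close> and \<open>C\<close>, hence solve the same first-order system.  On a
  compact interval the growth of their difference is bounded by a multiple of the difference itself.
\<close>

lemma fisher_geodesic_unique:
  fixes S1 S2 :: "real \<Rightarrow> real^'d^'d"
  assumes geo1: "fisher_geodesic k I1 m1 S1 m1' S1'" "{0..1} \<subseteq> I1"
    and geo2: "fisher_geodesic k I2 m2 S2 m2' S2'" "{0..1} \<subseteq> I2"
    and init: "m1 0 = m2 0" "S1 0 = S2 0" "m1' 0 = m2' 0" "S1' 0 = S2' 0"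
  shows "m1 1 = m2 1 \<and> S1 1 = S2 1"
proof -
  define p where "p = matrix_inv (S1 0) *v m1' 0"
  define C where "C = matrix_inv (S1 0) ** S1' 0 + k *\<^sub>R outer p (m1 0)"
  have der: "(m1 has_vector_derivative S1 t *v p) (at t)" "(m2 has_vector_derivative S2 t *v p) (at t)"
    "(S1 has_vector_derivative S1 t ** (C - k *\<^sub>R outer p (m1 t))) (at t)"
    "(S2 has_vector_derivative S2 t ** (C - k *\<^sub>R outer p (m2 t))) (at t)"
    if "t \<in> {0..1}" for t
  proof -
    have p2: "p = matrix_inv (S2 0) *v m2' 0" and C2: "C = matrix_inv (S2 0) ** S2' 0 + k *\<^sub>R outer p (m2 0)"
      using init by (simp_all add: p_def C_def)
    have t: "t \<in> I1" "t \<in> I2" using that geo1(2) geo2(2) by auto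
    show "(m1 has_vector_derivative S1 t *v p) (at t)" "(m2 has_vector_derivative S2 t *v p) (at t)"
      "(S1 has_vector_derivative S1 t ** (C - k *\<^sub>R outer p (m1 t))) (at t)"
      "(S2 has_vector_derivative S2 t ** (C - k *\<^sub>R outer p (m2 t))) (at t)"
      using geo1(1) geo2(1) t fisher_geodesic_first_integrals[OF geo1 p_def C_def that]
        fisher_geodesic_first_integrals[OF geo2 p2 C2 that]
      unfolding fisher_geodesic_def by metis+
  qed
  obtain B1 where B1: "0 \<le> B1" "\<And>t. t \<in> {0..1} \<Longrightarrow> norm (C - k *\<^sub>R outer p (m1 t)) \<le> B1"
    using bounded_norm_on_compact_interval[of 0 1 "\<lambda>t. C - k *\<^sub>R outer p (m1 t)",
      OF has_vector_derivative_diff[OF has_vector_derivative_const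
        bounded_linear.has_vector_derivative[OF bounded_linear_scaleR_right
          bounded_linear.has_vector_derivative[OF
            bounded_bilinear.bounded_linear_right[OF bounded_bilinear_outer] der(1)]]]]
    by metis
  obtain B2 where B2: "0 \<le> B2" "\<And>t. t \<in> {0..1} \<Longrightarrow> norm (S2 t) \<le> B2"
    using bounded_norm_on_compact_interval[OF der(4)] by metis
  obtain K1 where K1: "0 \<le> K1" "\<And>(X :: real^'d^'d) (x :: real^'d). norm (X *v x) \<le> norm X * norm x * K1"
    using bounded_bilinear.nonneg_bounded[OF bounded_bilinear_matrix_vector_mult] by blast
  obtain K2 where K2: "0 \<le> K2" "\<And>(X :: real^'d^'d) (Y :: real^'d^'d). norm (X ** Y) \<le> norm X * norm Y * K2"
    using bounded_bilinear.nonneg_bounded[OF bounded_bilinear_matrix_mult] by blast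
  obtain K3 where K3: "0 \<le> K3" "\<And>(x :: real^'d) (y :: real^'d). norm (outer x y) \<le> norm x * norm y * K3"
    using bounded_bilinear.nonneg_bounded[OF bounded_bilinear_outer] by blast
  let ?D = "\<lambda>t. (m1 t - m2 t, S1 t - S2 t)"
  let ?D' = "\<lambda>t. ((S1 t - S2 t) *v p, (S1 t - S2 t) ** (C - k *\<^sub>R outer p (m1 t))
      - k *\<^sub>R (S2 t ** outer p (m1 t - m2 t)))"
  let ?K = "norm p * K1 + (B1 * K2 + \<bar>k\<bar> * (B2 * (norm p * K3) * K2))"
  have "?D 1 = 0"
  proof (rule vanishes_if_derivative_norm_le[where a = 0 and D' = ?D' and K = ?K])
    fix t :: real assume "0 \<le> t" "t \<le> 1"
    then have t: "t \<in> {0..1}" by simp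
    show "(?D has_vector_derivative ?D' t) (at t)"
      by (rule has_vector_derivative_Pair[OF has_vector_derivative_diff[OF der(1,2)[OF t]]
            has_vector_derivative_diff[OF der(3,4)[OF t]], THEN has_vector_derivative_eq_rhs])
        (simp add: mv_simps mm_simps outer_simps scaleR_diff_right)
    have S: "norm (S1 t - S2 t) \<le> norm (?D t)" and m: "norm (m1 t - m2 t) \<le> norm (?D t)"
      using norm_snd_le[of "S1 t - S2 t" "m1 t - m2 t"] norm_fst_le[of "m1 t - m2 t" "S1 t - S2 t"] by auto
    have "norm ((S1 t - S2 t) *v p) \<le> norm (S1 t - S2 t) * (norm p * K1)"
      using K1(2)[of "S1 t - S2 t" p] by (simp add: mult.assoc)
    also have "\<dots> \<le> norm (?D t) * (norm p * K1)"
      by (rule mult_right_mono[OF S]) (simp add: K1(1))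
    finally have 1: "norm ((S1 t - S2 t) *v p) \<le> norm (?D t) * (norm p * K1)" .
    have "norm ((S1 t - S2 t) ** (C - k *\<^sub>R outer p (m1 t)))
        \<le> norm (S1 t - S2 t) * norm (C - k *\<^sub>R outer p (m1 t)) * K2"
      by (rule K2(2))
    also have "\<dots> \<le> norm (?D t) * B1 * K2"
      by (rule mult_right_mono[OF mult_mono[OF S B1(2)[OF t]]]) (simp_all add: K2(1))
    finally have 2: "norm ((S1 t - S2 t) ** (C - k *\<^sub>R outer p (m1 t))) \<le> norm (?D t) * B1 * K2" .
    have o: "norm (outer p (m1 t - m2 t)) \<le> norm p * norm (?D t) * K3"
      by (rule order_trans[OF K3(2) mult_right_mono[OF mult_left_mono[OF m]]]) (simp_all add: K3(1))
    have "norm (S2 t ** outer p (m1 t - m2 t)) \<le> norm (S2 t) * norm (outer p (m1 t - m2 t)) * K2"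
      by (rule K2(2))
    also have "\<dots> \<le> B2 * (norm p * norm (?D t) * K3) * K2"
      by (rule mult_right_mono[OF mult_mono[OF B2(2)[OF t] o]]) (simp_all add: K2(1) B2(1))
    finally have "\<bar>k\<bar> * norm (S2 t ** outer p (m1 t - m2 t))
        \<le> \<bar>k\<bar> * (B2 * (norm p * norm (?D t) * K3) * K2)"
      by (rule mult_left_mono) simp
    then have 3: "norm (k *\<^sub>R (S2 t ** outer p (m1 t - m2 t)))
        \<le> \<bar>k\<bar> * (B2 * (norm p * norm (?D t) * K3) * K2)"
      by simp
    have "norm (?D' t) \<le> norm ((S1 t - S2 t) *v p)
        + norm ((S1 t - S2 t) ** (C - k *\<^sub>R outer p (m1 t)) - k *\<^sub>R (S2 t ** outer p (m1 t - m2 t)))"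
      by (rule norm_Pair_le)
    also have "\<dots> \<le> norm ((S1 t - S2 t) *v p) + (norm ((S1 t - S2 t) ** (C - k *\<^sub>R outer p (m1 t)))
        + norm (k *\<^sub>R (S2 t ** outer p (m1 t - m2 t))))"
      by (rule add_left_mono[OF norm_triangle_ineq4])
    also have "\<dots> \<le> norm (?D t) * (norm p * K1) + (norm (?D t) * B1 * K2
        + \<bar>k\<bar> * (B2 * (norm p * norm (?D t) * K3) * K2))"
      by (intro add_mono 1 2 3)
    also have "\<dots> = ?K * norm (?D t)"
      by (simp only: distrib_right distrib_left mult_ac)
    finally show "norm (?D' t) \<le> ?K * norm (?D t)" .
  qed (simp_all add: init zero_prod_def)
  then show ?thesis by (simp add: zero_prod_def)
qed

text \<open>
  Uniqueness of geodesics is what makes the definite description of the exponential denote the endpoint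
  of a given geodesic.
\<close>

lemma gauss_exp_eq_fisher_geodesic:
  fixes S :: "real \<Rightarrow> real^'d^'d"
  assumes ab: "a > 0" "b > 0" and geo: "fisher_geodesic (b / a) I m S m' S'"
    and I: "open I" "is_interval I" "0 \<in> I" "1 \<in> I"
  shows "gauss_exp a b (m 0, S 0) (m' 0, S' 0) = (m 1, S 1)"
  unfolding gauss_exp_def riemannian_exp_def
proof (rule the_equality)
  have sub: "{0..1} \<subseteq> J" if "is_interval J" "0 \<in> J" "1 \<in> J" for J :: "real set"
    using mem_is_interval_1_I[OF that] by auto
  show "\<exists>I c c'. open I \<and> is_interval I \<and> 0 \<in> I \<and> 1 \<in> I
    \<and> is_geodesic gauss_tangent gauss_params (twisted_fisher a b) I c c'
    \<and> c 0 = (m 0, S 0) \<and> c' 0 = (m' 0, S' 0) \<and> c 1 = (m 1, S 1)"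
    using I geo is_geodesic_iff_fisher_geodesic[OF ab I(1), of "\<lambda>t. (m t, S t)" "\<lambda>t. (m' t, S' t)"]
    by (intro exI[of _ I] exI[of _ "\<lambda>t. (m t, S t)"] exI[of _ "\<lambda>t. (m' t, S' t)"]) simp
  fix q assume "\<exists>I c c'. open I \<and> is_interval I \<and> 0 \<in> I \<and> 1 \<in> I
    \<and> is_geodesic gauss_tangent gauss_params (twisted_fisher a b) I c c'
    \<and> c 0 = (m 0, S 0) \<and> c' 0 = (m' 0, S' 0) \<and> c 1 = q"
  then obtain J c c' where J: "open J" "is_interval J" "0 \<in> J" "1 \<in> J"
    and c: "is_geodesic gauss_tangent gauss_params (twisted_fisher a b) J c c'"
      "c 0 = (m 0, S 0)" "c' 0 = (m' 0, S' 0)" "c 1 = q" by blast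
  from c(1) have "fisher_geodesic (b / a) J (\<lambda>t. fst (c t)) (\<lambda>t. snd (c t)) (\<lambda>t. fst (c' t)) (\<lambda>t. snd (c' t))"
    by (simp add: is_geodesic_iff_fisher_geodesic[OF ab J(1)])
  from fisher_geodesic_unique[OF this sub[OF J(2-4)] geo sub[OF I(2-4)]] c
  show "q = (m 1, S 1)" by (simp add: prod_eq_iff)
qed

lemma fisher_geodesic_scale_time:
  fixes S :: "real \<Rightarrow> real^'d^'d"
  assumes geo: "fisher_geodesic k I m S m' S'"
  shows "fisher_geodesic k {t. r * t \<in> I} (\<lambda>t. m (r * t)) (\<lambda>t. S (r * t))
    (\<lambda>t. r *\<^sub>R m' (r * t)) (\<lambda>t. r *\<^sub>R S' (r * t))"
proof -
  have scale: "((\<lambda>t. f (r * t)) has_vector_derivative r *\<^sub>R f') (at t)"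
    if "(f has_vector_derivative f') (at (r * t))" for f f' t
    using has_vector_derivative_affine_reparam[where b = 0, of f f' r t] that by simp
  note scale2 = bounded_linear.has_vector_derivative[OF bounded_linear_scaleR_right scale]
  show ?thesis
    using geo unfolding fisher_geodesic_def
    by (auto intro!: scale scale2[THEN has_vector_derivative_eq_rhs]
        simp: mm_simps mv_simps outer_simps scaleR_diff_right)
qed

lemma gauss_exp_scaleR:
  fixes S :: "real \<Rightarrow> real^'d^'d"
  assumes ab: "a > 0" "b > 0" and geo: "fisher_geodesic (b / a) {-e<..<e} m S m' S'"
    and r: "\<bar>r\<bar> < e"
  shows "gauss_exp a b (m 0, S 0) (r *\<^sub>R m' 0, r *\<^sub>R S' 0) = (m r, S r)"
proof -
  let ?I = "{t. r * t \<in> {-e<..<e}}"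
  have "?I = (\<lambda>t. r * t) -` {-e<..<e}" by auto
  then have "open ?I" "is_interval ?I"
    by (auto intro!: open_vimage continuous_intros)
      (auto simp: is_interval_convex_1 intro!: convex_linear_vimage linearI simp: algebra_simps)
  then show ?thesis
    using gauss_exp_eq_fisher_geodesic[OF ab fisher_geodesic_scale_time[OF geo, of r]] r
    by (auto simp: abs_less_iff)
qed

section \<open>Local existence of geodesics\<close>

text \<open>
  An affine change of coordinates \<open>x \<mapsto> b + A x\<close> of the sample space acts on Gaussian distributions by
  isometries.  It reduces existence of geodesics to those that start at the standard Gaussian.
\<close>

lemma fisher_geodesic_affine:
  fixes A :: "real^'d^'d"
  assumes geo: "fisher_geodesic k I m S m' S'" and A: "invertible A"
  shows "fisher_geodesic k I (\<lambda>t. b + A *v m t) (\<lambda>t. A ** S t ** transpose A)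
    (\<lambda>t. A *v m' t) (\<lambda>t. A ** S' t ** transpose A)"
proof -
  note At = transpose_invertible[OF A]
  have pd: "pos_def (A ** X ** transpose A)" if "pos_def X" for X
  proof -
    have "x \<bullet> ((A ** X ** transpose A) *v x) = (transpose A *v x) \<bullet> (X *v (transpose A *v x))" for x
      by (simp only: inner_transpose_mult matrix_vector_mul_assoc matrix_mul_assoc)
    moreover have "transpose A *v x \<noteq> 0" if "x \<noteq> 0" for x
      using matrix_inv_cancel(5)[OF At, of x] that by (metis matrix_vector_mult_0_right)
    ultimately show ?thesis
      using that by (auto simp: pos_def_def sym_matrix_def matrix_transpose_mul matrix_mul_assoc
          simp del: transpose_matrix_vector)
  qed
  have inv: "matrix_inv (A ** X ** transpose A) = matrix_inv (transpose A) ** (matrix_inv X ** matrix_inv A)"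
    if "pos_def X" for X
    using pos_def_invertible[OF that] by (simp add: matrix_inv_mult A At invertible_mult)
  have vec: "((\<lambda>t. A *v f t) has_vector_derivative A *v f') (at t)"
    if "(f has_vector_derivative f') (at t)" for f f' t
    by (rule bounded_linear.has_vector_derivative[OF
          bounded_bilinear.bounded_linear_right[OF bounded_bilinear_matrix_vector_mult] that])
  have mat: "((\<lambda>t. A ** F t ** transpose A) has_vector_derivative A ** F' ** transpose A) (at t)"
    if "(F has_vector_derivative F') (at t)" for F F' t
    by (rule bounded_linear.has_vector_derivative[OF bounded_linear_matrix_mult_left
          bounded_linear.has_vector_derivative[OF bounded_linear_matrix_mult_right that]])
  have vec': "((\<lambda>t. b + A *v f t) has_vector_derivative A *v f') (at t)"
    if "(f has_vector_derivative f') (at t)" for f f' t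
    using has_vector_derivative_add[OF has_vector_derivative_const vec[OF that]] by simp
  have e1: "(A ** Y ** transpose A) ** matrix_inv (A ** X ** transpose A) *v (A *v x)
      = A *v (Y ** matrix_inv X *v x)" if "pos_def X" for X Y x
    unfolding inv[OF that]
    by (simp add: matrix_inv_cancel A At flip: matrix_mul_assoc matrix_vector_mul_assoc
        del: transpose_matrix_vector)
  have e2: "(A ** Y ** transpose A) ** matrix_inv (A ** X ** transpose A) ** (A ** Y ** transpose A)
      - k *\<^sub>R outer (A *v x) (A *v x)
      = A ** (Y ** matrix_inv X ** Y - k *\<^sub>R outer x x) ** transpose A" if "pos_def X" for X Y x
    unfolding inv[OF that]
    by (simp add: matrix_inv_cancel A At mm_simps mult_outer outer_mult flip: matrix_mul_assoc
        del: transpose_matrix_vector)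
  show ?thesis
    unfolding fisher_geodesic_def
  proof (intro ballI)
    fix t assume "t \<in> I"
    then have t: "pos_def (S t)" "(m has_vector_derivative m' t) (at t)" "(S has_vector_derivative S' t) (at t)"
      "(m' has_vector_derivative S' t ** matrix_inv (S t) *v m' t) (at t)"
      "(S' has_vector_derivative S' t ** matrix_inv (S t) ** S' t - k *\<^sub>R outer (m' t) (m' t)) (at t)"
      using geo unfolding fisher_geodesic_def by blast+
    show "pos_def (A ** S t ** transpose A)
      \<and> ((\<lambda>t. b + A *v m t) has_vector_derivative A *v m' t) (at t)
      \<and> ((\<lambda>t. A ** S t ** transpose A) has_vector_derivative A ** S' t ** transpose A) (at t)
      \<and> ((\<lambda>t. A *v m' t) has_vector_derivative
          (A ** S' t ** transpose A) ** matrix_inv (A ** S t ** transpose A) *v (A *v m' t)) (at t)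
      \<and> ((\<lambda>t. A ** S' t ** transpose A) has_vector_derivative
          (A ** S' t ** transpose A) ** matrix_inv (A ** S t ** transpose A) ** (A ** S' t ** transpose A)
          - k *\<^sub>R outer (A *v m' t) (A *v m' t)) (at t)"
      unfolding e1[OF t(1)] e2[OF t(1)] by (intro conjI pd vec' vec mat t)
  qed
qed

text \<open>
  The noncommutative algebra behind the explicit geodesics.  The relations let every word in the letters
  \<open>V, W, M, c, s\<close> be rewritten so that \<open>M\<close> stands left of \<open>c\<close>, \<open>c\<close> left of \<open>s\<close>, and the squares of \<open>V\<close> and \<open>c\<close>
  are eliminated; after that both sides of each identity agree as linear combinations of words.
\<close>

lemma gauss_riccati_identities:
  fixes V W M c s :: "real^'d^'d"
  assumes M: "4 *\<^sub>R M = V ** V + (2 * k) *\<^sub>R W"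
    and cM: "c ** M = M ** c" and sM: "s ** M = M ** s" and sc: "s ** c = c ** s"
    and cc: "c ** c = mat 1 + M ** (s ** s)"
  defines "N \<equiv> c - (1/2) *\<^sub>R (V ** s)" and "Nt \<equiv> c - (1/2) *\<^sub>R (s ** V)"
  shows "M ** s - (1/2) *\<^sub>R (V ** c) = (k/2) *\<^sub>R (W ** s) - (1/2) *\<^sub>R (V ** N)" (is ?A)
    and "M ** s - (1/2) *\<^sub>R (c ** V) = (k/2) *\<^sub>R (s ** W) - (1/2) *\<^sub>R (Nt ** V)" (is ?B)
    and "V ** (N ** Nt) - N ** Nt ** V = k *\<^sub>R (W ** (s ** Nt) - N ** (s ** W))" (is ?C)
    and "N ** c + (1/2) *\<^sub>R (V ** (N ** s)) = mat 1 + (k/2) *\<^sub>R (W ** (s ** s))" (is ?D)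
proof -
  have VV: "V ** V = 4 *\<^sub>R M - (2 * k) *\<^sub>R W" using M by simp
  have tails: "c ** (M ** X) = M ** (c ** X)" "s ** (M ** X) = M ** (s ** X)"
    "s ** (c ** X) = c ** (s ** X)" "c ** (c ** X) = X + M ** (s ** (s ** X))"
    "V ** (V ** X) = 4 *\<^sub>R (M ** X) - (2 * k) *\<^sub>R (W ** X)" for X
    by (simp_all add: matrix_mul_assoc cM sM sc cc VV mm_simps)
  note words = N_def Nt_def mm_simps cM sM sc cc VV tails matrix_mul_assoc[symmetric]
  show ?A by (simp add: words) (simp add: algebra_simps)
  show ?B by (simp add: words) (simp add: algebra_simps)
  show ?C by (simp add: words) (simp add: algebra_simps)
  show ?D by (simp add: words) (simp add: algebra_simps)
qed

text \<open>
  The geodesic through the standard Gaussian with velocity \<open>(v, V)\<close> in closed form.  Put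
  \<open>M = (V\<^sup>2 + 2 k v v\<^sup>T) / 4\<close>, let \<open>c\<close> and \<open>s\<close> be the associated hyperbolic functions, and set
  \<open>N = c - V s / 2\<close>.  In the natural parameters, which are the precision \<open>D = S\<^sup>-\<^sup>1\<close> and \<open>d = D m\<close>, the
  curve is \<open>D = N N\<^sup>T\<close> and \<open>d = N s v\<close>, and the identities above yield
  \<open>D' = k v d\<^sup>T - V D\<close> and \<open>d' = v + k (m \<bullet> d) v - V d\<close>.  Back in \<open>(m, S)\<close> this is the
  first-order system \<open>m' = S v\<close>, \<open>S' = S (V - k v m\<^sup>T)\<close>, whose solutions are geodesics.
\<close>

lemma fisher_geodesic_exists_normalized:
  fixes v :: "real^'d" and V :: "real^'d^'d"
  assumes V: "sym_matrix V"
  obtains e m S m' S' where "0 < e" "fisher_geodesic k {-e<..<e} m S m' S'"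
    "m 0 = 0" "S 0 = mat 1" "m' 0 = v" "S' 0 = V"
proof -
  define W where "W = outer v v"
  define M where "M = (1/4) *\<^sub>R (V ** V + (2 * k) *\<^sub>R W)"
  have Vt: "transpose V = V" using V by (simp add: sym_matrix_def)
  have Mt: "transpose M = M"
    by (simp add: M_def W_def transpose_linear_simps matrix_transpose_mul transpose_outer Vt)
  obtain c s where c': "\<And>t. (c has_vector_derivative M ** s t) (at t)"
    and s': "\<And>t. (s has_vector_derivative c t) (at t)" and c0: "c 0 = mat 1" and s0: "s 0 = 0"
    and sym: "\<And>t. transpose (c t) = c t" "\<And>t. transpose (s t) = s t"
    and comm: "\<And>t. c t ** M = M ** c t" "\<And>t. s t ** M = M ** s t" "\<And>t. s t ** c t = c t ** s t"
    and cc: "\<And>t. c t ** c t = mat 1 + M ** (s t ** s t)"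
    using matrix_cosh_sinh_exist[OF Mt] by blast
  define N where "N t = c t - (1/2) *\<^sub>R (V ** s t)" for t
  define D where "D t = N t ** transpose (N t)" for t
  define d where "d t = N t *v (s t *v v)" for t
  define S where "S t = matrix_inv (D t)" for t
  define m where "m t = S t *v d t" for t
  define S' where "S' t = S t ** (V - k *\<^sub>R outer v (m t))" for t
  have Nt: "transpose (N t) = c t - (1/2) *\<^sub>R (s t ** V)" for t
    by (simp add: N_def transpose_linear_simps matrix_transpose_mul sym Vt)
  have "4 *\<^sub>R M = V ** V + (2 * k) *\<^sub>R W" by (simp add: M_def)
  note id = gauss_riccati_identities[OF this comm(1) comm(2) comm(3) cc, folded Nt, folded N_def]
  have N': "(N has_vector_derivative (k/2) *\<^sub>R (W ** s t) - (1/2) *\<^sub>R (V ** N t)) (at t)" for t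
    unfolding id(1)[symmetric] unfolding N_def[abs_def]
    by (intro has_vector_derivative_diff c' bounded_linear.has_vector_derivative[OF bounded_linear_scaleR_right]
        bounded_linear.has_vector_derivative[OF bounded_linear_matrix_mult_right] s')
  have "N 0 = mat 1" by (simp add: N_def c0 s0 mm_simps)
  moreover have "continuous (at 0) N" using N' has_vector_derivative_continuous by blast
  ultimately have "\<forall>\<^sub>F t in nhds 0. invertible (N t)"
    using matrix_inv_unique_right(1)[of "mat 1" "mat 1"] by (intro eventually_invertible) simp_all
  \<comment> \<open>The curve is followed as long as \<open>N\<close> stays invertible.\<close>
  then obtain e where e: "0 < e" "\<And>t. dist t 0 < e \<Longrightarrow> invertible (N t)"
    unfolding eventually_nhds_metric by blast
  have geo: "pos_def (S t) \<and> (m has_vector_derivative S t *v v) (at t)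
      \<and> (S has_vector_derivative S' t) (at t)
      \<and> ((\<lambda>t. S t *v v) has_vector_derivative S' t ** matrix_inv (S t) *v (S t *v v)) (at t)
      \<and> (S' has_vector_derivative S' t ** matrix_inv (S t) ** S' t
          - k *\<^sub>R outer (S t *v v) (S t *v v)) (at t)" if "\<bar>t\<bar> < e" for t
  proof -
    have Ni: "invertible (N t)" using e that by simp
    note Nti = transpose_invertible[OF Ni]
    have Di: "invertible (D t)" unfolding D_def by (rule invertible_mult[OF Ni Nti])
    have S_eq: "S t = matrix_inv (transpose (N t)) ** matrix_inv (N t)"
      by (simp add: S_def D_def matrix_inv_mult Ni Nti)
    have pdS: "pos_def (S t)"
      unfolding S_def D_def by (rule pos_def_matrix_inv[OF pos_def_mult_transpose[OF Ni]])
    have St: "transpose (S t) = S t" using pdS by (simp add: pos_def_def sym_matrix_def)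
    have Si: "invertible (S t)" by (rule pos_def_invertible[OF pdS])
    have vd: "outer v (d t) = W ** (s t ** transpose (N t))"
      by (simp add: W_def d_def outer_mult matrix_transpose_mul sym matrix_vector_mul_assoc
          del: transpose_matrix_vector)
    have D': "(D has_vector_derivative k *\<^sub>R outer v (d t) - V ** D t) (at t)"
    proof -
      have "(D has_vector_derivative N t ** transpose ((k/2) *\<^sub>R (W ** s t) - (1/2) *\<^sub>R (V ** N t))
          + ((k/2) *\<^sub>R (W ** s t) - (1/2) *\<^sub>R (V ** N t)) ** transpose (N t)) (at t)"
        unfolding D_def[abs_def]
        by (rule has_vector_derivative_matrix_mult[OF N' has_vector_derivative_transpose[OF N']])
      also have "N t ** transpose ((k/2) *\<^sub>R (W ** s t) - (1/2) *\<^sub>R (V ** N t))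
          + ((k/2) *\<^sub>R (W ** s t) - (1/2) *\<^sub>R (V ** N t)) ** transpose (N t)
        = (k/2) *\<^sub>R (W ** (s t ** transpose (N t)) + N t ** (s t ** W))
          - (1/2) *\<^sub>R (V ** (N t ** transpose (N t)) + N t ** transpose (N t) ** V)"
        by (simp add: transpose_linear_simps matrix_transpose_mul sym Vt W_def transpose_outer mm_simps
            scaleR_add_right scaleR_diff_right flip: matrix_mul_assoc)
      also have "N t ** transpose (N t) ** V = V ** (N t ** transpose (N t))
          - k *\<^sub>R (W ** (s t ** transpose (N t)) - N t ** (s t ** W))"
        using id(3)[of t] by (simp add: algebra_simps)
      also have "(k/2) *\<^sub>R (W ** (s t ** transpose (N t)) + N t ** (s t ** W))
          - (1/2) *\<^sub>R (V ** (N t ** transpose (N t)) + (V ** (N t ** transpose (N t))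
          - k *\<^sub>R (W ** (s t ** transpose (N t)) - N t ** (s t ** W))))
        = k *\<^sub>R (W ** (s t ** transpose (N t))) - V ** (N t ** transpose (N t))"
        by (simp add: vec_eq_iff field_simps)
      finally show ?thesis unfolding vd D_def[abs_def] .
    qed
    have DS: "D t ** S t = mat 1" unfolding S_def by (rule matrix_inv_cancel(2)[OF Di])
    have S_der: "(S has_vector_derivative S' t) (at t)"
      unfolding S_def[abs_def]
      by (rule has_vector_derivative_matrix_inv[OF D' Di, THEN has_vector_derivative_eq_rhs])
        (simp add: S'_def m_def mm_simps mult_outer outer_mult St DS
          flip: S_def matrix_mul_assoc del: transpose_matrix_vector)
    define q where "q = v \<bullet> (s t *v (s t *v v))"
    have d': "(d has_vector_derivative v + (k * q) *\<^sub>R v - V *v d t) (at t)"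
    proof -
      have sv: "((\<lambda>t. s t *v v) has_vector_derivative c t *v v) (at t)"
        by (rule bounded_linear.has_vector_derivative[OF
              bounded_bilinear.bounded_linear_left[OF bounded_bilinear_matrix_vector_mult] s'])
      have "(d has_vector_derivative N t *v (c t *v v)
          + ((k/2) *\<^sub>R (W ** s t) - (1/2) *\<^sub>R (V ** N t)) *v (s t *v v)) (at t)"
        unfolding d_def[abs_def] by (rule has_vector_derivative_matrix_vector_mult[OF N' sv])
      also have "N t *v (c t *v v) = (N t ** c t) *v v" by (simp add: matrix_vector_mul_assoc)
      also have "N t ** c t = mat 1 + (k/2) *\<^sub>R (W ** (s t ** s t)) - (1/2) *\<^sub>R (V ** (N t ** s t))"
        using id(4)[of t] by (simp add: algebra_simps)
      finally show ?thesis
        by (rule has_vector_derivative_eq_rhs)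
          (simp add: mv_simps q_def d_def W_def outer_mult_vector vec_eq_iff field_simps
            flip: matrix_vector_mul_assoc)
    qed
    have dm: "m t \<bullet> d t = q"
    proof -
      have "d t \<bullet> m t = (s t *v v) \<bullet> (transpose (N t) *v m t)"
        unfolding d_def using inner_transpose_mult[of "transpose (N t)" "s t *v v" "m t"] by simp
      also have "transpose (N t) *v m t = s t *v v"
        unfolding m_def d_def S_eq
        by (simp add: matrix_inv_cancel Ni Nti del: transpose_matrix_vector flip: matrix_vector_mul_assoc)
      also have "(s t *v v) \<bullet> (s t *v v) = q"
        unfolding q_def using inner_transpose_mult[of "s t" v "s t *v v"] by (simp add: sym)
      finally show ?thesis by (simp add: inner_commute)
    qed
    have m_der: "(m has_vector_derivative S t *v v) (at t)"
      unfolding m_def[abs_def]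
      by (rule has_vector_derivative_matrix_vector_mult[OF S_der d', THEN has_vector_derivative_eq_rhs])
        (simp add: S'_def mv_simps outer_mult_vector dm flip: matrix_vector_mul_assoc)
    have Sv: "((\<lambda>t. S t *v v) has_vector_derivative S' t *v v) (at t)"
      by (rule bounded_linear.has_vector_derivative[OF
            bounded_bilinear.bounded_linear_left[OF bounded_bilinear_matrix_vector_mult] S_der])
    have "(S' has_vector_derivative S t ** (- (k *\<^sub>R outer v (S t *v v)))
        + S' t ** (V - k *\<^sub>R outer v (m t))) (at t)"
      unfolding S'_def[abs_def]
      by (rule has_vector_derivative_matrix_mult[OF S_der[unfolded S'_def]
            has_vector_derivative_diff[OF has_vector_derivative_const
              bounded_linear.has_vector_derivative[OF bounded_linear_scaleR_right
                bounded_linear.has_vector_derivative[OF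
                  bounded_bilinear.bounded_linear_right[OF bounded_bilinear_outer] m_der]],
              THEN has_vector_derivative_eq_rhs]]) simp
    moreover have "matrix_inv (S t) ** S' t = V - k *\<^sub>R outer v (m t)"
      by (simp add: S'_def matrix_inv_cancel Si)
    ultimately have "(S' has_vector_derivative S' t ** matrix_inv (S t) ** S' t
        - k *\<^sub>R outer (S t *v v) (S t *v v)) (at t)"
      by (simp add: mm_simps mult_outer flip: matrix_mul_assoc)
    then show ?thesis
      using pdS S_der m_der Sv by (simp add: matrix_inv_cancel Si flip: matrix_vector_mul_assoc)
  qed
  have "D 0 = mat 1" by (simp add: D_def \<open>N 0 = mat 1\<close>)
  then have S0: "S 0 = mat 1"
    by (simp add: S_def matrix_inv_unique_right(2)[of "mat 1" "mat 1"])
  moreover have m0: "m 0 = 0" by (simp add: m_def d_def s0)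
  moreover have "S' 0 = V"
    by (simp add: S'_def S0 m0 bounded_bilinear.zero_right[OF bounded_bilinear_outer])
  moreover have "fisher_geodesic k {-e<..<e} m S (\<lambda>t. S t *v v) S'"
    unfolding fisher_geodesic_def using geo by (auto simp: abs_less_iff)
  ultimately show ?thesis using that[OF e(1)] by simp
qed

section \<open>A Gaussian distribution determines its mean and covariance\<close>

lemma sym_matrix_eqI_quadratic_form:
  fixes P Q :: "real^'d^'d"
  assumes P: "sym_matrix P" and Q: "sym_matrix Q" and eq: "\<And>x. x \<bullet> (P *v x) = x \<bullet> (Q *v x)"
  shows "P = Q"
proof -
  have polar: "4 * (x \<bullet> (R *v y)) = (x + y) \<bullet> (R *v (x + y)) - (x - y) \<bullet> (R *v (x - y))"
    if "sym_matrix R" for R :: "real^'d^'d" and x y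
  proof -
    have "y \<bullet> (R *v x) = x \<bullet> (R *v y)"
      using inner_transpose_mult[of R y x] that unfolding sym_matrix_def by (metis inner_commute)
    then show ?thesis
      by (simp add: mv_simps inner_add_left inner_add_right inner_diff_left inner_diff_right)
  qed
  have "x \<bullet> (P *v y) = x \<bullet> (Q *v y)" for x y
    using polar[OF P, of x y] polar[OF Q, of x y] by (simp add: eq)
  then have "P *v y = Q *v y" for y
    using vector_eq_ldot by blast
  then show ?thesis by (simp add: matrix_eq)
qed

text \<open>
  The densities are continuous and agree almost everywhere, hence everywhere.  After taking logarithms,
  the two quadratic forms centred at the means differ by a constant.
\<close>

lemma gaussian_inject:
  fixes S T :: "real^'d^'d"
  assumes S: "pos_def S" and T: "pos_def T" and eq: "gaussian m S = gaussian n T"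
  shows "m = n" "S = T"
proof -
  define P where "P = matrix_inv S"
  define Q where "Q = matrix_inv T"
  have pd: "pos_def P" "pos_def Q" using S T by (simp_all add: P_def Q_def pos_def_matrix_inv)
  define p where "p x = (x - m) \<bullet> (P *v (x - m))" for x
  define q where "q x = (x - n) \<bullet> (Q *v (x - n))" for x
  define a where "a = sqrt ((2 * pi) ^ CARD('d) * det S)"
  define b where "b = sqrt ((2 * pi) ^ CARD('d) * det T)"
  have pos: "0 < a" "0 < b" using S T by (simp_all add: a_def b_def pos_def_det_pos)
  let ?f = "\<lambda>x. exp (- p x / 2) / a" and ?g = "\<lambda>x. exp (- q x / 2) / b"
  have cont: "continuous_on UNIV ?f" "continuous_on UNIV ?g"
    using pos unfolding p_def q_def
    by (auto intro!: continuous_intros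
        bounded_linear.continuous_on[OF matrix_vector_mul_bounded_linear])
  have "AE x in lborel. ennreal (?f x) = ennreal (?g x)"
  proof (rule sigma_finite_measure.density_unique[OF sigma_finite_lborel])
    show "density lborel (\<lambda>x. ennreal (?f x)) = density lborel (\<lambda>x. ennreal (?g x))"
      using eq unfolding gaussian_def p_def q_def a_def b_def P_def Q_def .
  qed (use cont in \<open>auto intro!: measurable_compose[OF borel_measurable_continuous_onI measurable_ennreal]\<close>)
  then have "AE x in lborel. x \<in> {x. ?f x = ?g x}"
    using pos by simp
  then have "AE x in lebesgue. x \<in> {x. ?f x = ?g x}"
    by (rule AE_completion)
  moreover have "closed {x. ?f x = ?g x}"
    using closed_Collect_eq[OF cont] .
  ultimately have "?f x = ?g x" for x
    using mem_closed_if_AE_lebesgue by blast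
  then have "ln (?f x) = ln (?g x)" for x by simp
  then have ln_eq: "- p x / 2 - ln a = - q x / 2 - ln b" for x
    using pos by (simp add: ln_div)
  define K where "K = 2 * (ln b - ln a)"
  have diff: "p x - q x = K" for x
    using ln_eq[of x] unfolding K_def by (simp add: field_simps)
  have nonneg: "0 \<le> q m" "0 \<le> p n"
    using pd unfolding p_def q_def pos_def_def by (metis inner_zero_left less_eq_real_def)+
  have "p m = 0" "q n = 0" by (simp_all add: p_def q_def)
  \<comment> \<open>The difference \<open>p - q\<close> is nonpositive at \<open>m\<close> and nonnegative at \<open>n\<close>, so the constant is \<open>0\<close>.\<close>
  with diff[of m] diff[of n] nonneg have q0: "q m = 0" and const: "K = 0" by linarith+
  show mn: "m = n"
    using q0 pd(2) unfolding q_def pos_def_def by (metis eq_iff_diff_eq_0 less_irrefl)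
  have "x \<bullet> (P *v x) = x \<bullet> (Q *v x)" for x
    using diff[of "x + m"] const by (simp add: p_def q_def mn)
  then have "P = Q"
    using pd by (intro sym_matrix_eqI_quadratic_form) (auto simp: pos_def_def)
  then show "S = T"
    using matrix_inv_matrix_inv[OF pos_def_invertible[OF S]] matrix_inv_matrix_inv[OF pos_def_invertible[OF T]]
    by (metis P_def Q_def)
qed

section \<open>GIGO and xNES trajectories\<close>

text \<open>
  With a constant mean, the geodesic equation is \<open>S'' = S' S\<^sup>-\<^sup>1 S'\<close>, which holds for
  \<open>S t = exp (t B)\<close> because \<open>S' = B S\<close>; congruence by \<open>A\<close> preserves it.
\<close>

lemma xnes_is_fisher_geodesic:
  fixes A B :: "real^'d^'d"
  assumes A: "invertible A" and B: "sym_matrix B"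
  shows "fisher_geodesic k I (\<lambda>t. \<mu>) (\<lambda>t. A ** matrix_exp (t *\<^sub>R B) ** transpose A)
    (\<lambda>t. 0) (\<lambda>t. A ** (B ** matrix_exp (t *\<^sub>R B)) ** transpose A)"
proof -
  have "fisher_geodesic k I (\<lambda>t. 0) (\<lambda>t. matrix_exp (t *\<^sub>R B))
      (\<lambda>t. 0) (\<lambda>t. B ** matrix_exp (t *\<^sub>R B))"
    unfolding fisher_geodesic_def
  proof (intro ballI conjI)
    fix t
    show "pos_def (matrix_exp (t *\<^sub>R B))"
      unfolding matrix_exp_half_square[OF B, of t] by (rule pos_def_mult_transpose[OF invertible_matrix_exp])
    show "((\<lambda>t. B ** matrix_exp (t *\<^sub>R B)) has_vector_derivative
        (B ** matrix_exp (t *\<^sub>R B)) ** matrix_inv (matrix_exp (t *\<^sub>R B)) ** (B ** matrix_exp (t *\<^sub>R B))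
        - k *\<^sub>R outer 0 0) (at t)"
      by (rule bounded_linear.has_vector_derivative[OF bounded_linear_matrix_mult_right
            has_vector_derivative_matrix_exp, THEN has_vector_derivative_eq_rhs])
        (simp add: matrix_inv_cancel invertible_matrix_exp outer_simps flip: matrix_mul_assoc)
  qed (auto simp: has_vector_derivative_matrix_exp)
  from fisher_geodesic_affine[OF this A, of \<mu>] show ?thesis by simp
qed

text \<open>
  The term \<open>k m' m'\<^sup>T\<close> is the defect of the covariance in the equation \<open>S'' = S' S\<^sup>-\<^sup>1 S'\<close>, so it can be
  read off from the path of the covariance.
\<close>

lemma fisher_geodesic_same_covariance:
  assumes geo: "fisher_geodesic k I m S m' S'" "fisher_geodesic k I n T n' T'"
    and I: "open I" "t \<in> I" and eq: "\<And>s. s \<in> I \<Longrightarrow> S s = T s" and k: "k \<noteq> 0"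
  shows "outer (m' t) (m' t) = outer (n' t) (n' t)"
proof -
  have "S' s = T' s" if "s \<in> I" for s
  proof -
    have "(S has_vector_derivative S' s) (at s)" "(T has_vector_derivative T' s) (at s)"
      using geo that by (auto simp: fisher_geodesic_def)
    moreover from this(2) have "(S has_vector_derivative T' s) (at s)"
      by (rule has_vector_derivative_transform_within_open[OF _ I(1) that]) (simp add: eq)
    ultimately show ?thesis using vector_derivative_unique_at by blast
  qed
  note eq' = this
  have d: "(S' has_vector_derivative S' t ** matrix_inv (S t) ** S' t - k *\<^sub>R outer (m' t) (m' t)) (at t)"
    "(T' has_vector_derivative T' t ** matrix_inv (T t) ** T' t - k *\<^sub>R outer (n' t) (n' t)) (at t)"
    using geo I(2) by (auto simp: fisher_geodesic_def)
  have "(S' has_vector_derivative T' t ** matrix_inv (T t) ** T' t - k *\<^sub>R outer (n' t) (n' t)) (at t)"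
    using d(2) by (rule has_vector_derivative_transform_within_open[OF _ I]) (simp add: eq')
  from vector_derivative_unique_at[OF this d(1)] show ?thesis
    using k by (simp add: eq eq' I(2))
qed

lemma fisher_geodesic_exists:
  fixes w :: "real^'d" and A X :: "real^'d^'d"
  assumes A: "invertible A" and X: "sym_matrix X"
  obtains e m S m' S' where "0 < e" "fisher_geodesic k {-e<..<e} m S m' S'"
    "m 0 = \<mu>" "S 0 = A ** transpose A" "m' 0 = w" "S' 0 = X"
proof -
  let ?V = "matrix_inv A ** X ** transpose (matrix_inv A)"
  have "sym_matrix ?V"
    using X by (simp add: sym_matrix_def matrix_transpose_mul matrix_mul_assoc)
  then obtain e m S m' S' where e: "0 < e" and geo: "fisher_geodesic k {-e<..<e} m S m' S'"
    and init: "m 0 = 0" "S 0 = mat 1" "m' 0 = matrix_inv A *v w" "S' 0 = ?V"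
    by (rule fisher_geodesic_exists_normalized)
  have "A ** ?V ** transpose A = X"
    by (simp add: matrix_inv_cancel A transpose_matrix_inv transpose_invertible flip: matrix_mul_assoc)
  then show ?thesis
    using that[OF e fisher_geodesic_affine[OF geo A, of \<mu>]] by (simp add: init matrix_inv_cancel A)
qed

theorem proposition43:
  fixes \<eta>\<^sub>\<mu> \<eta>\<^sub>\<Sigma> :: real
    and \<mu> v\<^sub>\<mu> :: "real^'d"
    and A \<Sigma> v\<^sub>\<Sigma> :: "real^'d^'d"
  assumes "\<eta>\<^sub>\<mu> > 0" and "\<eta>\<^sub>\<Sigma> > 0"
    and "invertible A" and "\<Sigma> = A ** transpose A"
    and "sym_matrix v\<^sub>\<Sigma>"
  shows "gigo_trajectory \<eta>\<^sub>\<mu> \<eta>\<^sub>\<Sigma> \<mu> \<Sigma> v\<^sub>\<mu> v\<^sub>\<Sigma> = xnes_trajectory \<eta>\<^sub>\<mu> \<eta>\<^sub>\<Sigma> \<mu> A v\<^sub>\<mu> v\<^sub>\<Sigma>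
    \<longleftrightarrow> v\<^sub>\<mu> = 0"
proof -
  note eta = assms(1,2) and A = assms(3) and \<Sigma> = assms(4) and sym = assms(5)
  define B where "B = \<eta>\<^sub>\<Sigma> *\<^sub>R (matrix_inv A ** v\<^sub>\<Sigma> ** transpose (matrix_inv A))"
  define T where "T t = A ** matrix_exp (t *\<^sub>R B) ** transpose A" for t
  define T' where "T' t = A ** (B ** matrix_exp (t *\<^sub>R B)) ** transpose A" for t
  let ?k = "\<eta>\<^sub>\<Sigma> / \<eta>\<^sub>\<mu>"
  have B: "sym_matrix B"
    using sym by (simp add: B_def sym_matrix_def transpose_linear_simps matrix_transpose_mul matrix_mul_assoc)
  have T: "fisher_geodesic ?k I (\<lambda>t. \<mu>) T (\<lambda>t. 0) T'" for I
    unfolding T_def[abs_def] T'_def[abs_def] by (rule xnes_is_fisher_geodesic[OF A B])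
  have T0: "T 0 = \<Sigma>" by (simp add: T_def \<Sigma> matrix_exp_0)
  have T'0: "T' 0 = \<eta>\<^sub>\<Sigma> *\<^sub>R v\<^sub>\<Sigma>"
    by (simp add: T'_def B_def matrix_exp_0 mm_simps matrix_inv_cancel A transpose_matrix_inv
        transpose_invertible flip: matrix_mul_assoc)
  have xnes: "xnes_trajectory \<eta>\<^sub>\<mu> \<eta>\<^sub>\<Sigma> \<mu> A v\<^sub>\<mu> v\<^sub>\<Sigma> t = gaussian (\<mu> + (t * \<eta>\<^sub>\<mu>) *\<^sub>R v\<^sub>\<mu>) (T t)" for t
    by (simp add: xnes_trajectory_def T_def B_def mult.commute)
  have gigo: "gigo_trajectory \<eta>\<^sub>\<mu> \<eta>\<^sub>\<Sigma> \<mu> \<Sigma> v\<^sub>\<mu> v\<^sub>\<Sigma> t = gaussian (m t) (S t)"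
    if "fisher_geodesic ?k {-e<..<e} m S m' S'" "\<bar>t\<bar> < e"
      "m 0 = \<mu>" "S 0 = \<Sigma>" "m' 0 = \<eta>\<^sub>\<mu> *\<^sub>R v\<^sub>\<mu>" "S' 0 = \<eta>\<^sub>\<Sigma> *\<^sub>R v\<^sub>\<Sigma>" for e m S m' S' t
    using gauss_exp_scaleR[OF eta that(1,2)] that by (simp add: gigo_trajectory_def)
  show ?thesis
  proof
    assume v: "v\<^sub>\<mu> = 0"
    show "gigo_trajectory \<eta>\<^sub>\<mu> \<eta>\<^sub>\<Sigma> \<mu> \<Sigma> v\<^sub>\<mu> v\<^sub>\<Sigma> = xnes_trajectory \<eta>\<^sub>\<mu> \<eta>\<^sub>\<Sigma> \<mu> A v\<^sub>\<mu> v\<^sub>\<Sigma>"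
    proof
      fix t
      show "gigo_trajectory \<eta>\<^sub>\<mu> \<eta>\<^sub>\<Sigma> \<mu> \<Sigma> v\<^sub>\<mu> v\<^sub>\<Sigma> t = xnes_trajectory \<eta>\<^sub>\<mu> \<eta>\<^sub>\<Sigma> \<mu> A v\<^sub>\<mu> v\<^sub>\<Sigma> t"
        \<comment> \<open>The xNES geodesic exists for all times; any interval around \<open>0\<close> that contains \<open>t\<close> will do.\<close>
        using gigo[OF T, of t "\<bar>t\<bar> + 1"] xnes[of t] by (simp add: T0 T'0 v)
    qed
  next
    assume eq: "gigo_trajectory \<eta>\<^sub>\<mu> \<eta>\<^sub>\<Sigma> \<mu> \<Sigma> v\<^sub>\<mu> v\<^sub>\<Sigma> = xnes_trajectory \<eta>\<^sub>\<mu> \<eta>\<^sub>\<Sigma> \<mu> A v\<^sub>\<mu> v\<^sub>\<Sigma>"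
    have "sym_matrix (\<eta>\<^sub>\<Sigma> *\<^sub>R v\<^sub>\<Sigma>)" using sym by (simp add: sym_matrix_def transpose_linear_simps)
    then obtain e m S m' S' where e: "0 < e" and geo: "fisher_geodesic ?k {-e<..<e} m S m' S'"
      and init: "m 0 = \<mu>" "S 0 = \<Sigma>" "m' 0 = \<eta>\<^sub>\<mu> *\<^sub>R v\<^sub>\<mu>" "S' 0 = \<eta>\<^sub>\<Sigma> *\<^sub>R v\<^sub>\<Sigma>"
      using fisher_geodesic_exists[OF A, of _ ?k \<mu> "\<eta>\<^sub>\<mu> *\<^sub>R v\<^sub>\<mu>"] unfolding \<Sigma> by metis
    have "S t = T t" if t: "t \<in> {-e<..<e}" for t
    proof (rule gaussian_inject(2))
      show "pos_def (S t)" "pos_def (T t)"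
        using geo T[of UNIV] t by (auto simp: fisher_geodesic_def)
      show "gaussian (m t) (S t) = gaussian (\<mu> + (t * \<eta>\<^sub>\<mu>) *\<^sub>R v\<^sub>\<mu>) (T t)"
        using gigo[OF geo _ init, of t] t by (simp add: eq xnes abs_less_iff)
    qed
    \<comment> \<open>The xNES covariance, taken with the fixed mean \<open>\<mu>\<close>, is a second geodesic with the same covariance path.\<close>
    then have "outer (m' 0) (m' 0) = outer 0 0"
      using e eta by (intro fisher_geodesic_same_covariance[OF geo T]) auto
    then have "outer (m' 0) (m' 0) = 0" by (simp add: outer_simps)
    then show "v\<^sub>\<mu> = 0" using eta by (simp add: outer_self_eq_0 init)
  qed
qed

end
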